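(* There is a randomized algorithm which, given an integer $k$, a set $X$ of $n$ points in $\mathbb{R}^d$ and $\delta\in(0,1)$, such that $k\ge|\mathrm{skyline}(X)|$, outputs $\mathrm{skyline}(X)$ with probability at least $1-\delta$, using $O(dkn\log(k/\delta))$ queries in expectation.
   Context: Noisy comparison model: queries are of the form "is the $i$-th coordinate of point $p$ (strictly) smaller than that of point $q$?"; each answer is correct with probability at least $2/3$, independently. A point $p$ is dominated by $q$ if $p_i\le q_i$ for every coordinate $i$, strictly dominated if also $p_i<q_i$ for some $i$. $\mathrm{skyline}(X)$ is the set of points of $X$ not strictly dominated by any other point of $X$. *)

theory Defs
  imports "HOL-Probability.Probability"
begin

text \<open>Points of \<open>\<real>\<^sup>d\<close> are real lists of length \<open>d\<close>, coordinates being numbered from 0; the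
  dimension has to be a term because algorithm and constant are uniform in it.\<close>

definition points :: "nat \<Rightarrow> real list set" where
  "points d = {p. length p = d}"

definition dominated :: "nat \<Rightarrow> real list \<Rightarrow> real list \<Rightarrow> bool" where
  "dominated d p q \<longleftrightarrow> (\<forall>i<d. p ! i \<le> q ! i)"

definition strictly_dominated :: "nat \<Rightarrow> real list \<Rightarrow> real list \<Rightarrow> bool" where
  "strictly_dominated d p q \<longleftrightarrow> dominated d p q \<and> (\<exists>i<d. p ! i < q ! i)"

definition skyline :: "nat \<Rightarrow> real list set \<Rightarrow> real list set" where
  "skyline d X = {p \<in> X. \<not> (\<exists>q\<in>X. q \<noteq> p \<and> strictly_dominated d p q)}"

text \<open>An algorithm never sees coordinates. The input points are given as an array \<open>xs\<close>, and the
  algorithm refers to a point by its position: \<open>Less i p q\<close> asks whether coordinate \<open>i\<close> of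
  \<open>xs ! p\<close> is strictly smaller than that of \<open>xs ! q\<close>. The correct answer to a query that is out
  of range is defined to be ``no''.\<close>

datatype query = Less (coord: nat) (left: nat) (right: nat)

fun truth :: "nat \<Rightarrow> real list list \<Rightarrow> query \<Rightarrow> bool" where
  "truth d xs (Less i p q) \<longleftrightarrow>
     i < d \<and> p < length xs \<and> q < length xs \<and> (xs ! p) ! i < (xs ! q) ! i"

text \<open>Randomized query algorithms with result type \<open>'r\<close>, as possibly infinite decision trees:
  stop with a result, ask a query and branch on the answer, or branch on a private random
  choice from an arbitrary discrete distribution.\<close>

codatatype 'r ralg =
    Return 'r
  | Ask query "bool \<Rightarrow> 'r ralg"
  | Sample "nat pmf" "nat \<Rightarrow> 'r ralg"

text \<open>\<open>acc t q\<close> is the probability that the answer is correct when \<open>q\<close> is asked after \<open>t\<close>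
  earlier queries. It may vary with \<open>t\<close> and \<open>q\<close> and is not known to the algorithm. It does not
  depend on earlier answers, and every answer is drawn afresh, also when a query is
  repeated, so the correctness events are independent.\<close>

definition admissible_accuracy :: "(nat \<Rightarrow> query \<Rightarrow> real) \<Rightarrow> bool" where
  "admissible_accuracy acc \<longleftrightarrow> (\<forall>t q. 2 / 3 \<le> acc t q \<and> acc t q \<le> 1)"

definition noisy_oracle ::
    "(nat \<Rightarrow> query \<Rightarrow> real) \<Rightarrow> nat \<Rightarrow> real list list \<Rightarrow> nat \<Rightarrow> query \<Rightarrow> bool pmf" where
  "noisy_oracle acc d xs t q =
     map_pmf (\<lambda>correct. if correct then truth d xs q else \<not> truth d xs q)
       (bernoulli_pmf (acc t q))"

text \<open>\<open>run orc m t a\<close> is the joint distribution of the result and the number of queries asked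
  when \<open>a\<close> is executed for \<open>m\<close> nodes of the tree, \<open>t\<close> queries having been asked before.
  The result is \<open>None\<close> if the algorithm has not stopped by then.\<close>

primrec run ::
    "(nat \<Rightarrow> query \<Rightarrow> bool pmf) \<Rightarrow> nat \<Rightarrow> nat \<Rightarrow> 'r ralg \<Rightarrow> ('r option \<times> nat) pmf" where
  "run orc 0 t a = return_pmf (None, t)"
| "run orc (Suc m) t a =
     (case a of
        Return r \<Rightarrow> return_pmf (Some r, t)
      | Ask q c \<Rightarrow> bind_pmf (orc t q) (\<lambda>b. run orc m (Suc t) (c b))
      | Sample D c \<Rightarrow> bind_pmf D (\<lambda>x. run orc m t (c x)))"

text \<open>Both quantities below are nondecreasing in \<open>m\<close>, so the suprema are the limits for the
  unbounded execution; executions that never stop contribute no result, but all of their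
  queries.\<close>

definition output_prob :: "(nat \<Rightarrow> query \<Rightarrow> bool pmf) \<Rightarrow> 'r ralg \<Rightarrow> 'r \<Rightarrow> real" where
  "output_prob orc a r = (SUP m. measure_pmf.prob (run orc m 0 a) {z. fst z = Some r})"

definition expected_queries :: "(nat \<Rightarrow> query \<Rightarrow> bool pmf) \<Rightarrow> 'r ralg \<Rightarrow> ennreal" where
  "expected_queries orc a = (SUP m. \<integral>\<^sup>+ z. of_nat (snd z) \<partial>measure_pmf (run orc m 0 a))"

end

theory Submission
  imports Defs
begin

text \<open>The points are processed one by one while a list \<open>S\<close> of skyline points is maintained. A point
  dominated by some \<open>s \<in> S\<close> is skipped. Otherwise one pass over the input finds the
  lexicographically largest point dominating it; this is a skyline point not yet in \<open>S\<close>, so there are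
  at most \<open>k\<close> passes. Without noise this costs \<open>O(dkn)\<close>.

  With noise, logarithms of \<open>n\<close> and \<open>d\<close> are avoided by tests with asymmetric error probabilities:
  a biased random walk whose two barriers are at distances \<open>u\<close> and \<open>l\<close> takes expected time \<open>O(u)\<close>
  when the first answer is the true one, and then errs with probability exponentially small in \<open>l\<close>.
  Hence an unexpected answer can be made very reliable at a cost paid only when it occurs.
  A skyline point is wrongly skipped with probability \<open>O(\<delta>/k)\<close>, and a dominated point triggers a
  superfluous pass with probability \<open>O(k/n)\<close>. In a pass, replacing a current point that has
  survived \<open>g\<close> comparisons needs confidence \<open>1 - \<delta> 2\<^sup>-\<^sup>g / k\<close>; the cost \<open>O(g)\<close> of reaching it is
  amortised over those \<open>g\<close> comparisons.\<close>

section \<open>Worst-case bounds for noisy programs\<close>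

text \<open>\<open>B\<close> bounds \<open>w\<close> times the expected number of queries plus the expectation of \<open>\<psi>\<close> at the result, for
  every admissible accuracy. The weight of \<open>B2\<close> is linear in the error probability, so the extreme
  values \<open>0\<close> and \<open>1/3\<close> suffice. Derivations are finite, hence they also certify termination.\<close>

inductive bnd :: "(query \<Rightarrow> bool) \<Rightarrow> real \<Rightarrow> ('r \<Rightarrow> real) \<Rightarrow> 'r ralg \<Rightarrow> real \<Rightarrow> bool"
  for tr w \<psi> where
  bnd_Return: "\<psi> r \<le> B \<Longrightarrow> bnd tr w \<psi> (Return r) B"
| bnd_Ask: "bnd tr w \<psi> (c (tr q)) B1 \<Longrightarrow> bnd tr w \<psi> (c (\<not> tr q)) B2 \<Longrightarrow> w + B1 \<le> B \<Longrightarrow>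
     w + 2/3 * B1 + 1/3 * B2 \<le> B \<Longrightarrow> bnd tr w \<psi> (Ask q c) B"

lemma bnd_mono: "bnd tr w \<psi> a B \<Longrightarrow> B \<le> B' \<Longrightarrow> bnd tr w \<psi> a B'"
  by (erule bnd.cases) (auto intro: bnd.intros order_trans)

lemma bnd_nonneg:
  assumes "bnd tr w \<psi> a B" "0 \<le> w" "\<And>r. 0 \<le> \<psi> r"
  shows "0 \<le> B"
  using assms(1)
proof induction
  case (bnd_Return r B)
  then show ?case using assms(3)[of r] by linarith
next
  case (bnd_Ask c q B1 B2 B)
  then show ?case using assms(2) by linarith
qed

section \<open>Soundness of the bounds for the noisy oracle\<close>

lemma noisy_oracle_correct:
  "noisy_oracle acc d xs t q = map_pmf (\<lambda>b. b = truth d xs q) (bernoulli_pmf (acc t q))"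
  unfolding noisy_oracle_def by (rule map_pmf_cong) auto

text \<open>The induction follows the derivation, with step limit \<open>m\<close> and clock
  \<open>t\<close> arbitrary: truncation only loses queries, and the accuracy may depend on
  \<open>t\<close>.\<close>

lemma expected_queries_run_le:
  fixes \<psi> :: "'r \<Rightarrow> real"
  assumes "bnd (truth d xs) 1 \<psi> a B" "admissible_accuracy acc" "\<And>r. 0 \<le> \<psi> r"
  shows "(\<integral>\<^sup>+ z. of_nat (snd z) \<partial>measure_pmf (run (noisy_oracle acc d xs) m t a)) \<le> ennreal (real t + B)"
  using assms(1)
proof (induction arbitrary: m t)
  case (bnd_Return r B)
  have "0 \<le> B" using bnd_Return assms(3)[of r] by linarith
  then have "ennreal (real t) \<le> ennreal (real t + B)" by (intro ennreal_leI) auto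
  then show ?case by (cases m) (auto simp: ennreal_of_nat_eq_real_of_nat)
next
  case (bnd_Ask c q B1 B2 B)
  have B: "0 \<le> B1" "0 \<le> B2"
    using bnd_nonneg[OF bnd_Ask.hyps(1) _ assms(3)] bnd_nonneg[OF bnd_Ask.hyps(2) _ assms(3)] by auto
  show ?case
  proof (cases m)
    case 0
    have "ennreal (real t) \<le> ennreal (real t + B)" using B bnd_Ask by (intro ennreal_leI) auto
    then show ?thesis using 0 by (auto simp: ennreal_of_nat_eq_real_of_nat)
  next
    case (Suc m')
    let ?p = "acc t q"
    let ?I = "\<lambda>b. \<integral>\<^sup>+ z. of_nat (snd z) \<partial>measure_pmf (run (noisy_oracle acc d xs) m' (Suc t) (c b))"
    have p: "2/3 \<le> ?p" "?p \<le> 1" using assms(2) by (auto simp: admissible_accuracy_def)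
    have "(\<integral>\<^sup>+ z. of_nat (snd z) \<partial>measure_pmf (run (noisy_oracle acc d xs) m t (Ask q c)))
      = ?I (truth d xs q) * ennreal ?p + ?I (\<not> truth d xs q) * ennreal (1 - ?p)"
      using p unfolding Suc noisy_oracle_correct
      by (simp add: nn_integral_bernoulli_pmf)
    also have "\<dots> \<le> ennreal (real (Suc t) + B1) * ennreal ?p + ennreal (real (Suc t) + B2) * ennreal (1 - ?p)"
      by (intro add_mono mult_right_mono bnd_Ask.IH) auto
    also have "\<dots> = ennreal ((real (Suc t) + B1) * ?p + (real (Suc t) + B2) * (1 - ?p))"
      using B p by (simp add: ennreal_mult'' ennreal_plus)
    also have "\<dots> \<le> ennreal (real t + B)"
    proof (rule ennreal_leI)
      \<comment> \<open>The expected bound is affine in the error probability \<open>1 - ?p\<close>,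
        which lies between 0 and 1/3; the sign of \<open>B2 - B1\<close> decides which side
        condition of \<open>bnd_Ask\<close> describes the worse end.\<close>
      have "B1 * ?p + B2 * (1 - ?p) \<le> B - 1"
      proof (cases "B1 \<le> B2")
        case True
        then have "(B2 - B1) * (1 - ?p) \<le> (B2 - B1) * (1/3)"
          using p by (intro mult_left_mono) auto
        then show ?thesis using bnd_Ask.hyps by (simp add: algebra_simps)
      next
        case False
        then have "(B2 - B1) * (1 - ?p) \<le> 0"
          using p by (intro mult_nonpos_nonneg) auto
        then show ?thesis using bnd_Ask.hyps by (simp add: algebra_simps)
      qed
      then show "(real (Suc t) + B1) * ?p + (real (Suc t) + B2) * (1 - ?p) \<le> real t + B"
        by (simp add: algebra_simps)
    qed
    finally show ?thesis .
  qed
qed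

lemma prob_bind_bernoulli:
  assumes "0 \<le> p" "p \<le> 1"
  shows "measure_pmf.prob (bind_pmf (bernoulli_pmf p) f) A =
    p * measure_pmf.prob (f True) A + (1 - p) * measure_pmf.prob (f False) A"
proof -
  have "ennreal (measure_pmf.prob (bind_pmf (bernoulli_pmf p) f) A) =
      ennreal (p * measure_pmf.prob (f True) A + (1 - p) * measure_pmf.prob (f False) A)"
    using assms
    by (simp add: measure_pmf.emeasure_eq_measure[symmetric] nn_integral_bernoulli_pmf)
       (simp add: measure_pmf.emeasure_eq_measure ennreal_mult'' ennreal_plus mult.commute)
  then show ?thesis using assms by (subst (asm) ennreal_inj) auto
qed

text \<open>With weight 0 and \<open>\<psi>\<close> the indicator of a wrong result,
  \<open>B\<close> bounds the failure probability. A derivation is a finite binary tree, so one step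
  limit \<open>m0\<close> serves all its branches.\<close>

lemma run_prob_ge:
  assumes "bnd (truth d xs) 0 (\<lambda>x. if x = r then 0 else 1) a B" "admissible_accuracy acc"
  shows "\<exists>m0. \<forall>m\<ge>m0. \<forall>t. measure_pmf.prob (run (noisy_oracle acc d xs) m t a) {z. fst z = Some r} \<ge> 1 - B"
  using assms(1)
proof induction
  case (bnd_Return x B)
  show ?case
  proof (intro exI[of _ 1] allI impI)
    fix m t :: nat assume "1 \<le> m"
    then show "1 - B \<le> measure_pmf.prob (run (noisy_oracle acc d xs) m t (Return x)) {z. fst z = Some r}"
      using bnd_Return by (cases m) (auto split: if_splits simp: measure_return_pmf)
  qed
next
  case (bnd_Ask c q B1 B2 B)
  obtain m1 m2 where m1: "\<And>m t. m \<ge> m1 \<Longrightarrow>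
      measure_pmf.prob (run (noisy_oracle acc d xs) m t (c (truth d xs q))) {z. fst z = Some r} \<ge> 1 - B1"
    and m2: "\<And>m t. m \<ge> m2 \<Longrightarrow>
      measure_pmf.prob (run (noisy_oracle acc d xs) m t (c (\<not> truth d xs q))) {z. fst z = Some r} \<ge> 1 - B2"
    using bnd_Ask.IH by blast
  show ?case
  proof (intro exI[of _ "Suc (max m1 m2)"] allI impI)
    fix m t :: nat assume "Suc (max m1 m2) \<le> m"
    then obtain m' where m: "m = Suc m'" "m1 \<le> m'" "m2 \<le> m'" by (cases m) auto
    let ?p = "acc t q"
    let ?I = "\<lambda>b. measure_pmf.prob (run (noisy_oracle acc d xs) m' (Suc t) (c b)) {z. fst z = Some r}"
    have p: "2/3 \<le> ?p" "?p \<le> 1" using assms(2) by (auto simp: admissible_accuracy_def)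
    have "measure_pmf.prob (run (noisy_oracle acc d xs) m t (Ask q c)) {z. fst z = Some r}
      = ?p * ?I (truth d xs q) + (1 - ?p) * ?I (\<not> truth d xs q)"
      using p unfolding m noisy_oracle_correct by (simp add: bind_map_pmf prob_bind_bernoulli)
    also have "\<dots> \<ge> ?p * (1 - max B1 0) + (1 - ?p) * max (1 - B2) 0"
      using p m1[OF m(2), of "Suc t"] m2[OF m(3), of "Suc t"] by (intro add_mono mult_left_mono) auto
    finally have *: "measure_pmf.prob (run (noisy_oracle acc d xs) m t (Ask q c)) {z. fst z = Some r}
      \<ge> ?p * (1 - max B1 0) + (1 - ?p) * max (1 - B2) 0" .
    have B: "0 \<le> B1" "0 \<le> B2"
      using bnd_nonneg[OF bnd_Ask.hyps(1)] bnd_nonneg[OF bnd_Ask.hyps(2)] by auto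
    have "?p * (1 - B1) + (1 - ?p) * (1 - B2) \<le> ?p * (1 - max B1 0) + (1 - ?p) * max (1 - B2) 0"
      using B p by (intro add_mono mult_left_mono) auto
    moreover have "B1 * ?p + B2 * (1 - ?p) \<le> B"
    proof (cases "B1 \<le> B2")
      case True
      then have "(B2 - B1) * (1 - ?p) \<le> (B2 - B1) * (1/3)"
        using p by (intro mult_left_mono) auto
      then show ?thesis using bnd_Ask.hyps by (simp add: algebra_simps)
    next
      case False
      then have "(B2 - B1) * (1 - ?p) \<le> 0"
        using p by (intro mult_nonpos_nonneg) auto
      then show ?thesis using bnd_Ask.hyps by (simp add: algebra_simps)
    qed
    ultimately show "1 - B \<le> measure_pmf.prob (run (noisy_oracle acc d xs) m t (Ask q c)) {z. fst z = Some r}"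
      using * by (simp add: algebra_simps)
  qed
qed

section \<open>A calculus of error probabilities\<close>

text \<open>Programs are in continuation-passing style. \<open>\<Delta>\<close> is the price of continuing with a wrong value, so
  \<open>\<epsilon>\<close> plays the role of the error probability and \<open>c\<close> that of the expected number of queries.\<close>

definition computes ::
    "(query \<Rightarrow> bool) \<Rightarrow> (('a \<Rightarrow> 'r ralg) \<Rightarrow> 'r ralg) \<Rightarrow> 'a \<Rightarrow> real \<Rightarrow> real \<Rightarrow> bool" where
  "computes tr P v \<epsilon> c \<longleftrightarrow> (\<forall>w \<psi> K B \<Delta>. 0 \<le> w \<longrightarrow> 0 \<le> \<Delta> \<longrightarrow> bnd tr w \<psi> (K v) B \<longrightarrow>
     (\<forall>a. bnd tr w \<psi> (K a) (B + \<Delta>)) \<longrightarrow> bnd tr w \<psi> (P K) (B + w * c + \<epsilon> * \<Delta>))"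

lemma computesD:
  "computes tr P v \<epsilon> c \<Longrightarrow> 0 \<le> w \<Longrightarrow> 0 \<le> \<Delta> \<Longrightarrow> bnd tr w \<psi> (K v) B \<Longrightarrow>
     (\<And>a. bnd tr w \<psi> (K a) (B + \<Delta>)) \<Longrightarrow> B + w * c + \<epsilon> * \<Delta> \<le> B' \<Longrightarrow> bnd tr w \<psi> (P K) B'"
  unfolding computes_def by (blast intro: bnd_mono)

lemma computes_mono:
  fixes P :: "('a \<Rightarrow> 'r ralg) \<Rightarrow> 'r ralg"
  assumes "computes tr P v \<epsilon> c" "\<epsilon> \<le> \<epsilon>'" "c \<le> c'"
  shows "computes tr P v \<epsilon>' c'"
  unfolding computes_def
proof (intro allI impI)
  fix w B \<Delta> :: real and \<psi> :: "'r \<Rightarrow> real" and K :: "'a \<Rightarrow> 'r ralg"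
  assume *: "0 \<le> w" "0 \<le> (\<Delta>::real)" "bnd tr w \<psi> (K v) B" "\<forall>a. bnd tr w \<psi> (K a) (B + \<Delta>)"
  have "B + w * c + \<epsilon> * \<Delta> \<le> B + w * c' + \<epsilon>' * \<Delta>"
    using * assms by (intro add_mono mult_left_mono mult_right_mono) auto
  then show "bnd tr w \<psi> (P K) (B + w * c' + \<epsilon>' * \<Delta>)"
    using * by (intro bnd_mono[OF computesD[OF assms(1) *(1,2), where B = B and K = K]]) auto
qed

lemma computes_Ask: "computes tr (Ask q) (tr q) (1/3) 1"
  unfolding computes_def
  by (intro allI impI bnd_Ask[where ?B1.0 = B and ?B2.0 = "B + \<Delta>" for B \<Delta>]) (auto simp: algebra_simps)

lemma computes_return: "computes tr (\<lambda>K. K x) x 0 0"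
  unfolding computes_def by auto

text \<open>Errors add up: once \<open>P\<close> has returned a wrong value, all later results are
  already charged \<open>B + \<Delta>\<close>, so \<open>Q\<close> continues at price 0 and
  contributes only its queries. Hence its cost bound is required for every \<open>a\<close>, not
  just for \<open>v\<close>.\<close>

lemma computes_bind:
  fixes P :: "('a \<Rightarrow> 'r ralg) \<Rightarrow> 'r ralg" and Q :: "'a \<Rightarrow> ('b \<Rightarrow> 'r ralg) \<Rightarrow> 'r ralg"
  assumes "computes tr P v \<epsilon> c" "\<And>a. computes tr (Q a) (f a) \<epsilon>' c'" "0 \<le> \<epsilon>'"
  shows "computes tr (\<lambda>K. P (\<lambda>a. Q a K)) (f v) (\<epsilon> + \<epsilon>') (c + c')"
  unfolding computes_def
proof (intro allI impI)
  fix w B \<Delta> :: real and \<psi> :: "'r \<Rightarrow> real" and K :: "'b \<Rightarrow> 'r ralg"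
  assume *: "0 \<le> w" "0 \<le> (\<Delta>::real)" "bnd tr w \<psi> (K (f v)) B" "\<forall>a. bnd tr w \<psi> (K a) (B + \<Delta>)"
  show "bnd tr w \<psi> (P (\<lambda>a. Q a K)) (B + w * (c + c') + (\<epsilon> + \<epsilon>') * \<Delta>)"
  proof (rule computesD[OF assms(1) *(1,2), where B = "B + w * c' + \<epsilon>' * \<Delta>"])
    show "bnd tr w \<psi> (Q v K) (B + w * c' + \<epsilon>' * \<Delta>)"
      using * by (intro computesD[OF assms(2) *(1,2), where B = B]) auto
    fix a
    show "bnd tr w \<psi> (Q a K) (B + w * c' + \<epsilon>' * \<Delta> + \<Delta>)"
      using *(1,4) mult_nonneg_nonneg[OF assms(3) *(2)]
      by (intro computesD[OF assms(2)[of a], where \<Delta> = 0 and B = "B + \<Delta>"]) auto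
  qed (simp add: algebra_simps)
qed

lemma computes_map:
  assumes "computes tr P v \<epsilon> c"
  shows "computes tr (\<lambda>K. P (\<lambda>a. K (f a))) (f v) \<epsilon> c"
  using computes_bind[OF assms, where Q = "\<lambda>a K. K (f a)", OF computes_return] by simp

section \<open>Biased random walks with asymmetric barriers\<close>

text \<open>\<open>c b\<close> is the distance to the barrier at which \<open>b\<close> is answered. \<open>N\<close> limits the number of steps,
  to keep the tree finite; the answer given when it is exhausted does not matter.\<close>

primrec walk ::
    "((bool \<Rightarrow> 'r ralg) \<Rightarrow> 'r ralg) \<Rightarrow> nat \<Rightarrow> (bool \<Rightarrow> nat) \<Rightarrow> (bool \<Rightarrow> 'r ralg) \<Rightarrow> 'r ralg" where
  "walk P 0 c K = K (c True = 0)"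
| "walk P (Suc N) c K =
     (if c True = 0 then K True else if c False = 0 then K False
      else P (\<lambda>b. walk P N (\<lambda>x. if x = b then c x - 1 else c x + 1) K))"

text \<open>The three terms are a linear potential for the drift, the supermartingale of the gambler's ruin
  problem, and a Chernoff bound for exhausting \<open>N\<close>, with
  \<open>2/3 * (3/2)\<^sup>-\<^sup>1 + 1/3 * (3/2) = 17/18\<close>.\<close>

lemma bnd_walk:
  assumes P: "computes tr P v \<epsilon> cP" and cP: "0 \<le> cP" and r: "0 < r" "r \<le> 1/2" "\<epsilon> \<le> r / (1 + r)"
    and w: "0 \<le> w" and \<Delta>: "0 \<le> \<Delta>" and v: "bnd tr w \<psi> (K v) B" and a: "\<And>a. bnd tr w \<psi> (K a) (B + \<Delta>)"
  shows "bnd tr w \<psi> (walk P N c K)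
     (B + w * (3 * cP * c v) + \<Delta> * (r ^ c (\<not> v) + (17/18) ^ N * (3/2) ^ c v))"
proof (induction N arbitrary: c)
  case 0
  have "\<Delta> * 1 \<le> \<Delta> * (r ^ c (\<not> v) + (3/2) ^ c v)"
    using r \<Delta> by (intro mult_left_mono add_increasing one_le_power) auto
  moreover have "0 \<le> w * (3 * cP * c v)" using w cP by simp
  ultimately show ?case by (auto intro!: bnd_mono[OF a] simp: algebra_simps)
next
  case (Suc N)
  have pos: "0 \<le> w * (3 * cP * c v)" "0 \<le> \<Delta> * (r ^ c (\<not> v) + (17/18) ^ Suc N * (3/2) ^ c v)"
    using w cP r \<Delta> by auto
  have r3: "r / (1 + r) \<le> 1/3" using r by (simp add: field_simps)
  show ?case
  proof (cases "c True = 0 \<or> c False = 0")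
    case True
    define x where "x = (c True = 0)"
    have eq: "walk P (Suc N) c K = K x" using True by (auto simp: x_def)
    show ?thesis
    proof (cases "x = v")
      case True
      then show ?thesis unfolding eq using pos by (intro bnd_mono[OF v[folded True]]) auto
    next
      case False
      then have "c (\<not> v) = 0" using \<open>c True = 0 \<or> c False = 0\<close> by (cases v) (auto simp: x_def)
      then have "\<Delta> * 1 \<le> \<Delta> * (r ^ c (\<not> v) + (17/18) ^ Suc N * (3/2) ^ c v)"
        using \<Delta> by (intro mult_left_mono) auto
      then show ?thesis unfolding eq using pos by (intro bnd_mono[OF a]) linarith
    qed
  next
    case False
    then have c0: "c v \<noteq> 0" "c (\<not> v) \<noteq> 0" by (cases v; auto)+
    then obtain u l where ul: "c v = Suc u" "c (\<not> v) = Suc l" by (meson not0_implies_Suc)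
    define q where "q = (17/18::real) ^ N * (3/2) ^ u"
    have q: "0 \<le> q" by (simp add: q_def)
    define h1 where "h1 = B + w * (3 * cP * u) + \<Delta> * (r ^ l * r\<^sup>2 + q)"
    define h2 where "h2 = B + w * (3 * cP * (u + 2)) + \<Delta> * (r ^ l + q * (9/4))"
    let ?W = "\<lambda>b. walk P N (\<lambda>x. if x = b then c x - 1 else c x + 1) K"
    have W1: "bnd tr w \<psi> (?W v) h1"
      using Suc[of "\<lambda>x. if x = v then c x - 1 else c x + 1"] ul
      by (simp add: h1_def q_def power2_eq_square algebra_simps)
    have W2: "bnd tr w \<psi> (?W (\<not> v)) h2"
      using Suc[of "\<lambda>x. if x = (\<not> v) then c x - 1 else c x + 1"] ul
      by (simp add: h2_def q_def power2_eq_square algebra_simps)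
    have r2: "r\<^sup>2 \<le> 1" using r by (simp add: power_le_one)
    have E: "h2 - h1 = w * cP * 6 + \<Delta> * (r ^ l * (1 - r\<^sup>2) + q * (5/4))"
      by (simp add: h1_def h2_def algebra_simps)
    have d0: "0 \<le> h2 - h1" unfolding E using w cP \<Delta> r r2 q by (intro add_nonneg_nonneg mult_nonneg_nonneg) auto
    \<comment> \<open>An error rate of \<open>r / (1 + r)\<close> means odds \<open>r\<close>. The
      ruin term needs exactly this rate:
      \<open>r ^ l * r\<^sup>2 + r ^ l * (r - r\<^sup>2) = r ^ Suc l\<close>. Drift and exhaustion
      only need a rate of at most 1/3, which follows from \<open>r \<le> 1/2\<close>.\<close>
    have "\<epsilon> * (h2 - h1) \<le> r / (1 + r) * (h2 - h1)" using r d0 by (intro mult_right_mono) auto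
    also have "\<dots> = r / (1 + r) * (w * cP * 6 + \<Delta> * (q * (5/4))) + \<Delta> * r ^ l * (r / (1 + r) * (1 - r\<^sup>2))"
      unfolding E by (simp add: algebra_simps)
    also have "r / (1 + r) * (1 - r\<^sup>2) = r - r\<^sup>2"
      using r by (simp add: field_simps power2_eq_square)
    also have "r / (1 + r) * (w * cP * 6 + \<Delta> * (q * (5/4))) \<le> 1/3 * (w * cP * 6 + \<Delta> * (q * (5/4)))"
      using r3 w cP \<Delta> q by (intro mult_right_mono) auto
    finally have *: "\<epsilon> * (h2 - h1) \<le> 1/3 * (w * cP * 6 + \<Delta> * (q * (5/4))) + \<Delta> * r ^ l * (r - r\<^sup>2)" by simp
    have "bnd tr w \<psi> (P ?W) (B + w * (3 * cP * c v) + \<Delta> * (r ^ c (\<not> v) + (17/18) ^ Suc N * (3/2) ^ c v))"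
    proof (rule computesD[OF P w d0, where B = h1])
      show "bnd tr w \<psi> (?W v) h1" by (rule W1)
      fix b
      show "bnd tr w \<psi> (?W b) (h1 + (h2 - h1))"
        using W1 W2 d0 by (cases "b = v") (auto intro: bnd_mono)
      have "(17/18::real) ^ Suc N * (3/2) ^ c v = q * (17/12)" by (simp add: ul q_def)
      then show "h1 + w * cP + \<epsilon> * (h2 - h1)
        \<le> B + w * (3 * cP * c v) + \<Delta> * (r ^ c (\<not> v) + (17/18) ^ Suc N * (3/2) ^ c v)"
        using * by (simp add: ul h1_def algebra_simps)
    qed
    then show ?thesis using False by simp
  qed
qed

text \<open>The true value is unknown to the algorithm, so the step limit is computed from
  \<open>c True + c False\<close>, which is at least either distance.\<close>

definition boost ::
    "real \<Rightarrow> (bool \<Rightarrow> nat) \<Rightarrow> ((bool \<Rightarrow> 'r ralg) \<Rightarrow> 'r ralg) \<Rightarrow> (bool \<Rightarrow> 'r ralg) \<Rightarrow> 'r ralg" where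
  "boost r c P = walk P (LEAST N. (17/18) ^ N * (3/2) ^ (c True + c False) \<le> r ^ (c True + c False)) c"

text \<open>\<open>r ^ c (\<not> v)\<close> occurs twice, for ruin at the wrong barrier and for
  exhausting the step limit. The cost involves only the distance to the right barrier, since a step
  moves towards it by at least 1/3 on average.\<close>

lemma computes_boost:
  fixes P :: "(bool \<Rightarrow> 'r ralg) \<Rightarrow> 'r ralg"
  assumes P: "computes tr P v \<epsilon> cP" and cP: "0 \<le> cP" and r: "0 < r" "r \<le> 1/2" "\<epsilon> \<le> r / (1 + r)"
  shows "computes tr (boost r c P) v (2 * r ^ c (\<not> v)) (3 * cP * c v)"
  unfolding computes_def
proof (intro allI impI)
  fix w B \<Delta> :: real and \<psi> :: "'r \<Rightarrow> real" and K :: "bool \<Rightarrow> 'r ralg"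
  assume *: "0 \<le> w" "0 \<le> (\<Delta>::real)" "bnd tr w \<psi> (K v) B" "\<forall>a. bnd tr w \<psi> (K a) (B + \<Delta>)"
  let ?Q = "\<lambda>N::nat. (17/18) ^ N * (3/2::real) ^ (c True + c False) \<le> r ^ (c True + c False)"
  define N where "N = (LEAST N. ?Q N)"
  obtain N0 where "(17/18::real) ^ N0 < r ^ (c True + c False) / (3/2) ^ (c True + c False)"
    using real_arch_pow_inv[of "r ^ (c True + c False) / (3/2) ^ (c True + c False)" "17/18"] r by auto
  then have "?Q N0" by (simp add: field_simps)
  then have N: "?Q N" unfolding N_def by (rule LeastI)
  have "(17/18) ^ N * (3/2::real) ^ c v \<le> (17/18) ^ N * (3/2) ^ (c True + c False)"
    by (intro mult_left_mono power_increasing) (cases v; auto)+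
  also note N
  also have "r ^ (c True + c False) \<le> r ^ c (\<not> v)"
    using r by (intro power_decreasing) (cases v; auto)+
  finally have "\<Delta> * (r ^ c (\<not> v) + (17/18) ^ N * (3/2) ^ c v) \<le> \<Delta> * (2 * r ^ c (\<not> v))"
    using * by (intro mult_left_mono) auto
  then show "bnd tr w \<psi> (boost r c P K) (B + w * (3 * cP * real (c v)) + 2 * r ^ c (\<not> v) * \<Delta>)"
    unfolding boost_def N_def[symmetric] using *
    by (intro bnd_mono[OF bnd_walk[OF P cP r *(1,2), where B = B]]) (auto simp: algebra_simps)
qed

section \<open>Noisy search for the first hit in a list\<close>

primrec noisy_find :: "('i \<Rightarrow> (bool \<Rightarrow> 'r ralg) \<Rightarrow> 'r ralg) \<Rightarrow> 'i list \<Rightarrow> ('i option \<Rightarrow> 'r ralg) \<Rightarrow> 'r ralg" where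
  "noisy_find T [] K = K None"
| "noisy_find T (i # is) K = T i (\<lambda>b. if b then K (Some i) else noisy_find T is K)"

text \<open>False alarms can spoil the result only before the first hit, and only the first hit can
  be missed. After a miss the search may meet further hits, but each is missed with probability at
  most 1/2, so on average at most two tests of cost \<open>cT\<close> are made.\<close>

lemma computes_noisy_find:
  fixes T :: "'i \<Rightarrow> (bool \<Rightarrow> 'r ralg) \<Rightarrow> 'r ralg" and e f cT cF :: real
  assumes T: "\<And>i. computes tr (T i) (P i) (if P i then e else f) (if P i then cT else cF)"
    and c: "0 \<le> cT" "0 \<le> cF" and ef: "0 \<le> e" "e \<le> 1/2" "0 \<le> f"
  shows "computes tr (noisy_find T is) (List.find P is) (length is * f + e) (length is * cF + 2 * cT)"
proof -
  \<comment> \<open>The cost of a search whose result no longer matters; it is used after a missed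
    hit.\<close>
  have any: "bnd tr w \<psi> (noisy_find T is K) (M + w * (length is * cF + 2 * cT))"
    if w: "0 \<le> w" and K: "\<And>a. bnd tr w \<psi> (K a) M" for w M :: real and \<psi> :: "'r \<Rightarrow> real" and K "is"
  proof (induction "is")
    case Nil
    then show ?case using w c by (auto intro!: bnd_mono[OF K])
  next
    case (Cons i "is")
    let ?R = "w * (length is * cF + 2 * cT)"
    have R: "0 \<le> ?R" using w c by simp
    let ?K = "\<lambda>b. if b then K (Some i) else noisy_find T is K"
    show ?case
    proof (cases "P i")
      case True
      have "bnd tr w \<psi> (T i ?K) (M + w * (length (i # is) * cF + 2 * cT))"
      proof (rule computesD[OF T w R])
        show "bnd tr w \<psi> (?K (P i)) M" using True K by simp
        fix a show "bnd tr w \<psi> (?K a) (M + ?R)"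
          using Cons bnd_mono[OF K] R by auto
        have "e * ?R \<le> 1/2 * ?R" using ef R by (intro mult_right_mono) auto
        moreover have "0 \<le> w * cF * length is" "0 \<le> w * cF" using w c by auto
        ultimately show "M + w * (if P i then cT else cF) + (if P i then e else f) * ?R
          \<le> M + w * (length (i # is) * cF + 2 * cT)"
          using True by (simp add: algebra_simps)
      qed
      then show ?thesis by simp
    next
      case False
      have "bnd tr w \<psi> (T i ?K) (M + w * (length (i # is) * cF + 2 * cT))"
      proof (rule computesD[OF T w order_refl])
        show "bnd tr w \<psi> (?K (P i)) (M + ?R)" using False Cons by simp
        fix a show "bnd tr w \<psi> (?K a) (M + ?R + 0)"
          using Cons bnd_mono[OF K] R by auto
      qed (use False in \<open>simp add: algebra_simps\<close>)
      then show ?thesis by simp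
    qed
  qed
  show ?thesis
    unfolding computes_def
  proof (intro allI impI)
    fix w B \<Delta> :: real and \<psi> :: "'r \<Rightarrow> real" and K :: "'i option \<Rightarrow> 'r ralg"
    assume w: "0 \<le> w" and \<Delta>: "0 \<le> (\<Delta>::real)" and *: "bnd tr w \<psi> (K (List.find P is)) B"
      and K: "\<forall>a. bnd tr w \<psi> (K a) (B + \<Delta>)"
    from * show "bnd tr w \<psi> (noisy_find T is K) (B + w * (length is * cF + 2 * cT) + (length is * f + e) * \<Delta>)"
    proof (induction "is")
      case Nil
      then show ?case using w c \<Delta> ef by (auto intro!: bnd_mono[OF Nil.prems, simplified])
    next
      case (Cons i "is")
      let ?K = "\<lambda>b. if b then K (Some i) else noisy_find T is K"
      let ?R = "w * (length is * cF + 2 * cT)"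
      have R: "0 \<le> ?R" using w c by simp
      have D: "0 \<le> (length is * f + e) * \<Delta>" using ef \<Delta> by simp
      show ?case
      proof (cases "P i")
        case True
        have "bnd tr w \<psi> (T i ?K) (B + w * (length (i # is) * cF + 2 * cT) + (length (i # is) * f + e) * \<Delta>)"
        proof (rule computesD[OF T w])
          \<comment> \<open>A missed hit incurs the price of a wrong result and also the rest of the
            search.\<close>
          show "0 \<le> \<Delta> + ?R" using R \<Delta> by simp
          show "bnd tr w \<psi> (?K (P i)) B" using True Cons.prems by simp
          fix a show "bnd tr w \<psi> (?K a) (B + (\<Delta> + ?R))"
            using any[OF w K[rule_format], of "is"] bnd_mono[OF K[rule_format]] R by (auto simp: algebra_simps)
          have "e * ?R \<le> 1/2 * ?R" using ef R by (intro mult_right_mono) auto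
          moreover have "0 \<le> w * cF * length is" "0 \<le> w * cF" "0 \<le> f * \<Delta>" "0 \<le> length is * (f * \<Delta>)"
            using w c ef \<Delta> by auto
          ultimately show "B + w * (if P i then cT else cF) + (if P i then e else f) * (\<Delta> + ?R)
            \<le> B + w * (length (i # is) * cF + 2 * cT) + (length (i # is) * f + e) * \<Delta>"
            using True by (simp add: algebra_simps)
        qed
        then show ?thesis by simp
      next
        case False
        then have IH: "bnd tr w \<psi> (noisy_find T is K) (B + ?R + (length is * f + e) * \<Delta>)"
          using Cons by simp
        have "bnd tr w \<psi> (T i ?K) (B + w * (length (i # is) * cF + 2 * cT) + (length (i # is) * f + e) * \<Delta>)"
        proof (rule computesD[OF T w \<Delta>])
          show "bnd tr w \<psi> (?K (P i)) (B + ?R + (length is * f + e) * \<Delta>)" using False IH by simp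
          fix a show "bnd tr w \<psi> (?K a) (B + ?R + (length is * f + e) * \<Delta> + \<Delta>)"
            using bnd_mono[OF IH] bnd_mono[OF K[rule_format]] R D \<Delta> by auto
        qed (use False in \<open>simp add: algebra_simps\<close>)
        then show ?thesis by simp
      qed
    qed
  qed
qed

section \<open>Noisy scan for a maximum\<close>

text \<open>\<open>g\<close> counts the elements examined since \<open>x\<close> became the current one.\<close>

primrec scan :: "(nat \<Rightarrow> 'i \<Rightarrow> 'i \<Rightarrow> (bool \<Rightarrow> 'r ralg) \<Rightarrow> 'r ralg) \<Rightarrow> 'i list \<Rightarrow> nat \<Rightarrow> 'i \<Rightarrow> ('i \<Rightarrow> 'r ralg) \<Rightarrow> 'r ralg" where
  "scan T [] g x K = K x"
| "scan T (q # qs) g x K = T g q x (\<lambda>b. if b then scan T qs 1 q K else scan T qs (g + 1) x K)"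

text \<open>Errors made before \<open>m\<close> arrives are harmless, because \<open>m\<close> beats
  whatever is current then. The result is wrong only if \<open>m\<close> is rejected on arrival or
  displaced later.\<close>

lemma computes_scan:
  fixes beats :: "'i \<Rightarrow> 'i \<Rightarrow> bool" and T :: "nat \<Rightarrow> 'i \<Rightarrow> 'i \<Rightarrow> (bool \<Rightarrow> 'r ralg) \<Rightarrow> 'r ralg"
    and C \<beta> e :: real
  assumes T: "\<And>g q x. computes tr (T g q x) (beats q x) (if beats q x then e else e * (1/2) ^ g)
      (if beats q x then C * (\<beta> + g) else C * \<beta>)"
    and C: "0 \<le> C" "0 \<le> \<beta>" and e: "0 \<le> e" "e \<le> 1/2"
    and m: "\<And>x. x \<in> I \<Longrightarrow> x \<noteq> m \<Longrightarrow> beats m x" "\<And>x. x \<in> I \<Longrightarrow> \<not> beats x m"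
    and I: "set qs \<subseteq> I" "x \<in> I" "m \<in> set qs"
  shows "computes tr (scan T qs 1 x) m (2 * e) (length qs * (C * \<beta> + 2 * C) + 2 * C)"
  unfolding computes_def
proof (intro allI impI)
  fix w B \<Delta> :: real and \<psi> :: "'r \<Rightarrow> real" and K :: "'i \<Rightarrow> 'r ralg"
  assume w: "0 \<le> w" and \<Delta>: "0 \<le> (\<Delta>::real)" and Km: "bnd tr w \<psi> (K m) B"
    and K: "\<forall>a. bnd tr w \<psi> (K a) (B + \<Delta>)"
  \<comment> \<open>\<open>F\<close> bounds the probability of a wrong result. While
    \<open>m\<close> is current it can be displaced at ages \<open>g\<close>, \<open>g + 1\<close>,
    and so on, which sums to \<open>e * 2 * (1/2) ^ g\<close>. If \<open>m\<close> is still to come,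
    one \<open>e\<close> is for rejecting it and another for displacing it from age 1 on.\<close>
  define F where "F = (\<lambda>qs g x. if x = m then e * 2 * (1/2) ^ g else if m \<in> set qs then 2 * e else 1)"
  \<comment> \<open>Each examined element deposits \<open>2 * C\<close>, so \<open>2 * C * g\<close>
    is saved at age \<open>g\<close>. A justified replacement spends half of it on its surcharge
    \<open>C * g\<close>; the other half covers the chance \<open>e \<le> 1/2\<close> that it is
    refused and the savings have to be kept.\<close>
  define H where "H = (\<lambda>(qs :: 'i list) g. w * (length qs * (C * \<beta> + 2 * C) + 2 * C * real g))"
  have F0: "0 \<le> F qs g x" for qs g x using e by (auto simp: F_def)
  have "bnd tr w \<psi> (scan T qs g x K) (B + H qs g + \<Delta> * F qs g x)"
    if "set qs \<subseteq> I" "x \<in> I" "1 \<le> g" for qs g x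
    using that
  proof (induction qs arbitrary: g x)
    case Nil
    have "0 \<le> H [] g" using w C by (simp add: H_def)
    moreover have "0 \<le> \<Delta> * F [] g x" using F0 \<Delta> by simp
    moreover have "\<Delta> * F [] g x = \<Delta>" if "x \<noteq> m" using that by (simp add: F_def)
    ultimately show ?case
      using bnd_mono[OF Km, of "B + H [] g + \<Delta> * F [] g x"]
        bnd_mono[OF K[rule_format], of "B + H [] g + \<Delta> * F [] g x" x]
      by (cases "x = m") auto
  next
    case (Cons q qs)
    let ?S = "\<lambda>b. if b then scan T qs 1 q K else scan T qs (g + 1) x K"
    have A: "bnd tr w \<psi> (scan T qs 1 q K) (B + H qs 1 + \<Delta> * F qs 1 q)"
      using Cons.prems by (intro Cons.IH) auto
    have R: "bnd tr w \<psi> (scan T qs (g + 1) x K) (B + H qs (g + 1) + \<Delta> * F qs (g + 1) x)"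
      using Cons.prems by (intro Cons.IH) auto
    have H1: "H qs 1 \<le> H qs (g + 1)" "H qs (g + 1) = H qs 1 + w * C * 2 * g"
      using w C by (auto simp: H_def algebra_simps intro!: mult_left_mono)
    have Hs: "H (q # qs) g = H qs 1 + w * C * \<beta> + w * C * 2 * g" by (simp add: H_def algebra_simps)
    have wC: "0 \<le> w * C" using w C by simp
    have "bnd tr w \<psi> (T g q x ?S) (B + H (q # qs) g + \<Delta> * F (q # qs) g x)"
    proof (cases "beats q x")
      case True
      then have xm: "x \<noteq> m" using m(2) Cons.prems by auto
      \<comment> \<open>\<open>F\<close> is the same for both answers unless \<open>m\<close> is
        involved: a wrong answer is charged only if it rejects \<open>m\<close> here, and only if it
        displaces \<open>m\<close> in the other case.\<close>
      define D where "D = (if q = m then \<Delta> else 0)"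
      have D: "0 \<le> D" using \<Delta> by (simp add: D_def)
      have FR: "\<Delta> * F qs (g + 1) x \<le> \<Delta> * F qs 1 q + D"
      proof (cases "q = m")
        case True
        have "F qs (g + 1) x \<le> F qs 1 q + 1" using F0[of qs 1 q] e by (auto simp: F_def xm True)
        then have "\<Delta> * F qs (g + 1) x \<le> \<Delta> * (F qs 1 q + 1)" using \<Delta> by (rule mult_left_mono)
        then show ?thesis using True by (simp add: D_def algebra_simps)
      qed (auto simp: F_def xm D_def)
      have FF: "\<Delta> * F qs 1 q + e * D \<le> \<Delta> * F (q # qs) g x"
        using \<Delta> e by (auto simp: F_def xm D_def algebra_simps)
      have X0: "0 \<le> D + w * C * 2 * g" using D wC by simp
      have "e * (w * C * 2 * g) \<le> 1/2 * (w * C * 2 * g)" using e wC by (intro mult_right_mono) auto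
      then have ee: "e * (w * C * 2 * g) \<le> w * C * g" by simp
      show ?thesis
      proof (rule computesD[OF T w X0])
        show "bnd tr w \<psi> (?S (beats q x)) (B + H qs 1 + \<Delta> * F qs 1 q)" using True A by simp
        let ?X = "B + H qs 1 + \<Delta> * F qs 1 q + (D + w * C * 2 * g)"
        have "B + H qs 1 + \<Delta> * F qs 1 q \<le> ?X" "B + H qs (g + 1) + \<Delta> * F qs (g + 1) x \<le> ?X"
          using FR H1 X0 by linarith+
        then show "bnd tr w \<psi> (?S a) ?X" for a
          using bnd_mono[OF A, of ?X] bnd_mono[OF R, of ?X] by simp
        show "B + H qs 1 + \<Delta> * F qs 1 q + w * (if beats q x then C * (\<beta> + g) else C * \<beta>) +
          (if beats q x then e else e * (1/2) ^ g) * (D + w * C * 2 * g)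
          \<le> B + H (q # qs) g + \<Delta> * F (q # qs) g x"
          using True ee FF unfolding Hs by (simp add: algebra_simps)
      qed
    next
      case False
      then have qm: "x = m \<or> q \<noteq> m" using m(1) Cons.prems by auto
      define D where "D = (if x = m then \<Delta> else 0)"
      have D: "0 \<le> D" using \<Delta> by (simp add: D_def)
      have FR: "\<Delta> * F qs 1 q \<le> \<Delta> * F qs (g + 1) x + D"
      proof (cases "x = m")
        case True
        have "F qs 1 q \<le> 1" using e by (auto simp: F_def)
        then have "F qs 1 q \<le> F qs (g + 1) x + 1" using F0[of qs "g + 1" x] by linarith
        then have "\<Delta> * F qs 1 q \<le> \<Delta> * (F qs (g + 1) x + 1)" using \<Delta> by (rule mult_left_mono)
        then show ?thesis using True by (simp add: D_def algebra_simps)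
      qed (use qm in \<open>auto simp: F_def D_def\<close>)
      have FF: "\<Delta> * F qs (g + 1) x + e * (1/2) ^ g * D \<le> \<Delta> * F (q # qs) g x"
        using \<Delta> e qm by (auto simp: F_def D_def algebra_simps)
      show ?thesis
      proof (rule computesD[OF T w D])
        show "bnd tr w \<psi> (?S (beats q x)) (B + H qs (g + 1) + \<Delta> * F qs (g + 1) x)" using False R by simp
        let ?X = "B + H qs (g + 1) + \<Delta> * F qs (g + 1) x + D"
        have "B + H qs 1 + \<Delta> * F qs 1 q \<le> ?X" "B + H qs (g + 1) + \<Delta> * F qs (g + 1) x \<le> ?X"
          using FR H1 D by linarith+
        then show "bnd tr w \<psi> (?S a) ?X" for a
          using bnd_mono[OF A, of ?X] bnd_mono[OF R, of ?X] by simp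
        show "B + H qs (g + 1) + \<Delta> * F qs (g + 1) x + w * (if beats q x then C * (\<beta> + g) else C * \<beta>) +
          (if beats q x then e else e * (1/2) ^ g) * D
          \<le> B + H (q # qs) g + \<Delta> * F (q # qs) g x"
          using False FF H1 unfolding Hs by (simp add: algebra_simps)
      qed
    qed
    then show ?case by simp
  qed
  from this[OF I(1,2), of 1]
  show "bnd tr w \<psi> (scan T qs 1 x K) (B + w * (length qs * (C * \<beta> + 2 * C) + 2 * C) + 2 * e * \<Delta>)"
  proof (rule bnd_mono)
    have "F qs 1 x \<le> 2 * e" using e I by (auto simp: F_def)
    then have "\<Delta> * F qs 1 x \<le> \<Delta> * (2 * e)" using \<Delta> by (rule mult_left_mono)
    then show "B + H qs 1 + \<Delta> * F qs 1 x \<le> B + w * (length qs * (C * \<beta> + 2 * C) + 2 * C) + 2 * e * \<Delta>"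
      by (simp add: H_def algebra_simps)
  qed simp
qed

section \<open>The greedy algorithm\<close>

text \<open>A correct pass for an uncovered point finds a point outside \<open>S\<close>. A result
  inside \<open>S\<close> therefore reveals an error, and \<open>p\<close> is skipped as if
  covered.\<close>

primrec greedy :: "('i \<Rightarrow> 'i list \<Rightarrow> (bool \<Rightarrow> 'i set ralg) \<Rightarrow> 'i set ralg) \<Rightarrow>
    ('i \<Rightarrow> ('i \<Rightarrow> 'i set ralg) \<Rightarrow> 'i set ralg) \<Rightarrow> nat \<Rightarrow> 'i list \<Rightarrow> 'i list \<Rightarrow> 'i set ralg" where
  "greedy T M k [] S = Return (set S)"
| "greedy T M k (p # ps) S = T p S (\<lambda>b. if b then greedy T M k ps S
     else M p (\<lambda>s. if s \<in> set S then greedy T M k ps S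
       else if k \<le> length S then Return {} else greedy T M k ps (s # S)))"

text \<open>The test for \<open>k \<le> length S\<close> only bounds the cost of executions in which an error has occurred:
  the number of remaining insertions is a potential that pays for the passes.\<close>

lemma greedy_cost:
  fixes cT cF eT eF P \<epsilon> :: real
  assumes T: "\<And>p S. length S \<le> k \<Longrightarrow> computes tr (T p S) (cov p S) (if cov p S then eT else eF) (if cov p S then cT else cF)"
    and M: "\<And>p. p \<in> set ps \<Longrightarrow> computes tr (M p) (m p) \<epsilon> P"
    and m: "\<And>p S. p \<in> set ps \<Longrightarrow> \<not> cov p S \<Longrightarrow> m p \<notin> set S"
    and e: "0 \<le> eT" "eF \<le> 1/3" "\<epsilon> \<le> 1/2" and c: "0 \<le> cT" "0 \<le> cF" "0 \<le> P"
    and S: "length S \<le> k"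
  shows "bnd tr 1 (\<lambda>_. 0) (greedy T M k ps S)
    (length ps * (cT + eT * P) + 3 * (real k + 1 - length S) * (cF + P))"
  using M m S
proof (induction ps arbitrary: S)
  case Nil
  then show ?case using c by (auto intro!: bnd_Return)
next
  case (Cons p ps)
  define X where "X = (\<lambda>S :: 'a list. length ps * (cT + eT * P) + 3 * (real k + 1 - length S) * (cF + P))"
  have IH: "bnd tr 1 (\<lambda>_. 0) (greedy T M k ps S') (X S')" if "length S' \<le> k" for S'
    unfolding X_def using Cons.prems(1,2) that by (intro Cons.IH) auto
  let ?Kp = "\<lambda>s. if s \<in> set S then greedy T M k ps S
       else if k \<le> length S then Return {} else greedy T M k ps (s # S)"
  let ?K = "\<lambda>b. if b then greedy T M k ps S else M p ?Kp"
  \<comment> \<open>An insertion releases \<open>3 * (cF + P)\<close>. A pass fails with probability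
    at most 1/2, so at least half is gained on average, which pays \<open>P\<close> and leaves
    \<open>3/2 * cF\<close>; errors of the test forfeit at most a third of that, and the remaining
    \<open>cF\<close> pays the test. The \<open>1\<close> in \<open>k + 1\<close> is for the
    insertion refused when \<open>S\<close> is full.\<close>
  define Y where "Y = X S - 3 * (cF + P)"
  have XC: "X (s # S) = Y" for s by (simp add: X_def Y_def algebra_simps)
  have "0 \<le> length ps * (cT + eT * P)" "0 \<le> (real k - length S) * (cF + P)"
    using c e Cons.prems(3) by auto
  then have Y0: "0 \<le> Y" by (simp add: X_def Y_def algebra_simps)
  have YX: "Y \<le> X S" using c by (simp add: Y_def)
  have Kany: "bnd tr 1 (\<lambda>_. 0) (?Kp s) (X S)" for s
    using Y0 YX IH[of S] Cons.prems(3) bnd_mono[OF IH[of "s # S"], of "X S"] XC[of s]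
    by (auto intro!: bnd_Return)
  have "bnd tr 1 (\<lambda>_. 0) (T p S ?K) (length (p # ps) * (cT + eT * P) + 3 * (real k + 1 - length S) * (cF + P))"
  proof (cases "cov p S")
    case True
    show ?thesis
    proof (rule computesD[OF T, where B = "X S" and \<Delta> = P])
      show "bnd tr 1 (\<lambda>_. 0) (?K (cov p S)) (X S)" using True IH Cons.prems by simp
      have "bnd tr 1 (\<lambda>_. 0) (M p ?Kp) (X S + P)"
        using Kany c by (intro computesD[OF Cons.prems(1), where \<Delta> = 0 and B = "X S"]) auto
      then show "bnd tr 1 (\<lambda>_. 0) (?K a) (X S + P)" for a
        using bnd_mono[OF IH, of S "X S + P"] c Cons.prems(3) by simp
      show "X S + 1 * (if cov p S then cT else cF) + (if cov p S then eT else eF) * P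
        \<le> length (p # ps) * (cT + eT * P) + 3 * (real k + 1 - length S) * (cF + P)"
        using True by (simp add: X_def algebra_simps)
    qed (use c Cons.prems(3) in simp_all)
  next
    case False
    then have mS: "m p \<notin> set S" using Cons.prems(2) by simp
    have D: "0 \<le> 3 * (cF + P)" using c by simp
    have M1: "bnd tr 1 (\<lambda>_. 0) (M p ?Kp) (X S - 3/2 * cF)"
    proof (rule computesD[OF Cons.prems(1) _ D, where B = Y])
      show "bnd tr 1 (\<lambda>_. 0) (?Kp (m p)) Y"
        using mS Y0 IH[of "m p # S"] XC[of "m p"] by (auto intro!: bnd_Return)
      show "bnd tr 1 (\<lambda>_. 0) (?Kp s) (Y + 3 * (cF + P))" for s
        using Kany by (simp add: Y_def)
      have "\<epsilon> * (3 * (cF + P)) \<le> 1/2 * (3 * (cF + P))" using e D by (intro mult_right_mono) auto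
      then show "Y + 1 * P + \<epsilon> * (3 * (cF + P)) \<le> X S - 3/2 * cF"
        using c by (simp add: Y_def algebra_simps)
    qed auto
    show ?thesis
    proof (rule computesD[OF T, where B = "X S - 3/2 * cF" and \<Delta> = "3/2 * cF"])
      show "bnd tr 1 (\<lambda>_. 0) (?K (cov p S)) (X S - 3/2 * cF)" using False M1 by simp
      show "bnd tr 1 (\<lambda>_. 0) (?K a) (X S - 3/2 * cF + 3/2 * cF)" for a
        using bnd_mono[OF M1, of "X S"] IH[of S] c Cons.prems(3) by simp
      have "eF * (3/2 * cF) \<le> 1/3 * (3/2 * cF)" using e c by (intro mult_right_mono) auto
      moreover have "0 \<le> eT * P" using e c by simp
      ultimately show "X S - 3/2 * cF + 1 * (if cov p S then cT else cF) + (if cov p S then eT else eF) * (3/2 * cF)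
        \<le> length (p # ps) * (cT + eT * P) + 3 * (real k + 1 - length S) * (cF + P)"
        using False c by (simp add: X_def algebra_simps)
    qed (use c Cons.prems(3) in simp_all)
  qed
  then show ?case by simp
qed

lemma greedy_error:
  fixes cT cF eT eF P \<epsilon> :: real
  assumes T: "\<And>p S. length S \<le> k \<Longrightarrow> computes tr (T p S) (cov p S) (if cov p S then eT else eF) (if cov p S then cT else cF)"
    and M: "\<And>p. p \<in> set ps \<Longrightarrow> computes tr (M p) (m p) \<epsilon> P"
    and m: "\<And>p S. p \<in> set ps \<Longrightarrow> \<not> cov p S \<Longrightarrow> m p \<notin> set S"
      "\<And>p. p \<in> set ps \<Longrightarrow> m p \<in> Y" "\<And>p. p \<in> Y \<Longrightarrow> m p = p"
    and cov: "\<And>p S. p \<in> Y \<Longrightarrow> set S \<subseteq> Y \<Longrightarrow> cov p S \<Longrightarrow> p \<in> set S"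
    and Y: "finite Y" "card Y \<le> k"
    and e: "0 \<le> eT" "0 \<le> eF" "0 \<le> \<epsilon>"
    and S: "distinct S" "set S \<subseteq> Y" "Y \<subseteq> set S \<union> set ps"
  shows "bnd tr 0 (\<lambda>x. if x = Y then 0 else 1) (greedy T M k ps S)
    ((real k - length S) * \<epsilon> + length (filter (\<lambda>p. p \<in> Y) ps) * eF + length ps * (eT * \<epsilon>))"
proof -
  let ?\<psi> = "\<lambda>x. if x = Y then 0 else 1 :: real"
  \<comment> \<open>The trivial bound 1 on a failure probability, available also where the invariant
    is broken.\<close>
  have any: "bnd tr 0 ?\<psi> (greedy T M k ps S) 1" if "length S \<le> k" "\<And>p. p \<in> set ps \<Longrightarrow> computes tr (M p) (m p) \<epsilon> P" for ps S
    using that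
  proof (induction ps arbitrary: S)
    case Nil
    then show ?case by (auto intro: bnd_Return)
  next
    case (Cons p ps)
    have IH: "bnd tr 0 ?\<psi> (greedy T M k ps S') 1" if "length S' \<le> k" for S'
      using Cons that by auto
    have "bnd tr 0 ?\<psi> (M p (\<lambda>s. if s \<in> set S then greedy T M k ps S
       else if k \<le> length S then Return {} else greedy T M k ps (s # S))) 1"
      using IH Cons.prems by (intro computesD[OF Cons.prems(2), where B = 1 and \<Delta> = 0]) (auto intro: bnd_Return)
    then show ?case
      using IH Cons.prems by (simp, intro computesD[OF T, where B = 1 and \<Delta> = 0]) auto
  qed
  have len: "length S \<le> k" if "distinct S" "set S \<subseteq> Y" for S
    using that Y card_mono[of Y "set S"] by (simp add: distinct_card)
  show ?thesis
    using M m(1,2) S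
  proof (induction ps arbitrary: S)
    case Nil
    then have "set S = Y" by auto
    then show ?case using e Nil len[of S] by (auto intro!: bnd_Return)
  next
    case (Cons p ps)
    define X where "X = (\<lambda>S :: 'a list. (real k - length S) * \<epsilon> + length (filter (\<lambda>p. p \<in> Y) ps) * eF + length ps * (eT * \<epsilon>))"
    have lS: "length S \<le> k" using len Cons.prems by auto
    have IH: "bnd tr 0 ?\<psi> (greedy T M k ps S') (X S')"
      if "distinct S'" "set S' \<subseteq> Y" "Y \<subseteq> set S' \<union> set ps" for S'
      unfolding X_def using Cons.prems(1-3) that by (intro Cons.IH) auto
    have any': "bnd tr 0 ?\<psi> (greedy T M k ps S') 1" if "length S' \<le> k" for S'
      using any that Cons.prems(1) by auto
    let ?Kp = "\<lambda>s. if s \<in> set S then greedy T M k ps S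
         else if k \<le> length S then Return {} else greedy T M k ps (s # S)"
    let ?K = "\<lambda>b. if b then greedy T M k ps S else M p ?Kp"
    have X0: "0 \<le> X S'" if "length S' \<le> k" for S' using that e by (simp add: X_def)
    have Kp1: "bnd tr 0 ?\<psi> (?Kp s) 1" for s using any' lS by (auto intro: bnd_Return)
    have Mp: "bnd tr 0 ?\<psi> (M p ?Kp) (B + \<epsilon>)" if "0 \<le> B" "bnd tr 0 ?\<psi> (?Kp (m p)) B" for B
    proof (rule computesD[OF Cons.prems(1), where B = B and \<Delta> = 1])
      show "bnd tr 0 ?\<psi> (?Kp s) (B + 1)" for s using bnd_mono[OF Kp1] that by simp
    qed (use that in auto)
    have Mnew: "bnd tr 0 ?\<psi> (M p ?Kp) (X S)" if "m p \<notin> set S"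
    proof -
      have mY: "m p \<in> Y" using Cons.prems by auto
      have l: "length (m p # S) \<le> k"
        by (rule len) (use that mY Cons.prems in auto)
      have "bnd tr 0 ?\<psi> (greedy T M k ps (m p # S)) (X (m p # S))"
        using that mY Cons.prems m(3)[of p] by (intro IH) auto
      then have "bnd tr 0 ?\<psi> (?Kp (m p)) (X (m p # S))" using that l by auto
      from Mp[OF X0[OF l] this] show ?thesis by (simp add: X_def algebra_simps)
    qed
    have Mall: "bnd tr 0 ?\<psi> (M p ?Kp) (X S + \<epsilon>)"
    proof (cases "m p \<in> set S")
      case True
      then have "bnd tr 0 ?\<psi> (greedy T M k ps S) (X S)"
        using Cons.prems m(3)[of p] by (intro IH) auto
      then show ?thesis using True X0[OF lS] by (intro Mp) auto
    next
      case False
      then show ?thesis using bnd_mono[OF Mnew] e by simp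
    qed
    have "bnd tr 0 ?\<psi> (T p S ?K) ((real k - length S) * \<epsilon> + length (filter (\<lambda>p. p \<in> Y) (p # ps)) * eF
       + length (p # ps) * (eT * \<epsilon>))"
    proof (cases "cov p S")
      case True
      then have pY: "p \<in> Y \<Longrightarrow> p \<in> set S" using cov Cons.prems by auto
      have G: "bnd tr 0 ?\<psi> (greedy T M k ps S) (X S)"
        using Cons.prems pY by (intro IH) auto
      show ?thesis
      proof (rule computesD[OF T[OF lS], where B = "X S" and \<Delta> = \<epsilon>])
        show "bnd tr 0 ?\<psi> (?K (cov p S)) (X S)" using True G by simp
        show "bnd tr 0 ?\<psi> (?K a) (X S + \<epsilon>)" for a using Mall bnd_mono[OF G] e by simp
      qed (use True e in \<open>auto simp: X_def algebra_simps\<close>)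
    next
      case False
      then have M1: "bnd tr 0 ?\<psi> (M p ?Kp) (X S)" using Mnew Cons.prems by auto
      define D where "D = (if p \<in> Y then 1 else 0 :: real)"
      show ?thesis
      proof (rule computesD[OF T[OF lS], where B = "X S" and \<Delta> = D])
        show "bnd tr 0 ?\<psi> (?K (cov p S)) (X S)" using False M1 by simp
        have "bnd tr 0 ?\<psi> (greedy T M k ps S) (X S + D)"
        proof (cases "p \<in> Y")
          case True
          then show ?thesis using bnd_mono[OF any'[OF lS]] X0[OF lS] by (simp add: D_def)
        next
          case False
          then show ?thesis using Cons.prems by (auto simp: D_def intro!: IH)
        qed
        then show "bnd tr 0 ?\<psi> (?K a) (X S + D)" for a using bnd_mono[OF M1] by (simp add: D_def)
      qed (use False e in \<open>auto simp: X_def D_def algebra_simps\<close>)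
    qed
    then show ?case by simp
  qed
qed

section \<open>Tests on points\<close>

definition query_test :: "nat \<Rightarrow> query \<Rightarrow> (bool \<Rightarrow> 'r ralg) \<Rightarrow> 'r ralg" where
  "query_test b q = boost (1/2) (\<lambda>_. b) (Ask q)"

lemma computes_query_test: "computes tr (query_test b q) (tr q) (2 * (1/2) ^ b) (3 * real b)"
  unfolding query_test_def
  using computes_boost[OF computes_Ask, where r = "1/2" and c = "\<lambda>_. b", of tr q] by simp

text \<open>The search is for a coordinate refuting domination. Confirming it at distance
  \<open>b + d\<close> makes the false alarms of all \<open>d\<close> coordinates together no
  likelier than one error at level \<open>b\<close>, since \<open>d * (1/2) ^ d \<le> 1\<close>. The
  extra cost falls due only at true refutations, of which at most two are tested on average.\<close>

definition dom_test :: "nat \<Rightarrow> nat \<Rightarrow> nat \<Rightarrow> nat \<Rightarrow> (bool \<Rightarrow> 'r ralg) \<Rightarrow> 'r ralg" where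
  "dom_test d b p s K =
     noisy_find (\<lambda>i. boost (1/2) (\<lambda>x. if x then b + d else b) (Ask (Less i s p))) [0..<d] (\<lambda>z. K (z = None))"

definition dom_truth :: "(query \<Rightarrow> bool) \<Rightarrow> nat \<Rightarrow> nat \<Rightarrow> nat \<Rightarrow> bool" where
  "dom_truth tr d p s \<longleftrightarrow> (\<forall>i<d. \<not> tr (Less i s p))"

lemma real_half_power_le_one: "real d * (1/2) ^ d \<le> 1"
  using of_nat_mono[OF less_imp_le[OF less_exp[of d]], where 'a = real]
  by (simp add: power_divide field_simps)

lemma two_half_power_le_half: "2 \<le> b \<Longrightarrow> 2 * (1/2::real) ^ b \<le> 1/2"
  using power_decreasing[of 2 b "1/2::real"] by (simp add: power2_eq_square)

lemma computes_dom_test: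
  assumes "2 \<le> b" "1 \<le> d"
  shows "computes tr (dom_test d b p s :: (bool \<Rightarrow> 'r ralg) \<Rightarrow> 'r ralg) (dom_truth tr d p s) (4 * (1/2) ^ b) (15 * real b * real d)"
proof -
  let ?P = "\<lambda>i. tr (Less i s p)"
  let ?T = "\<lambda>i. boost (1/2) (\<lambda>x. if x then b + d else b) (Ask (Less i s p)) :: (bool \<Rightarrow> 'r ralg) \<Rightarrow> 'r ralg"
  have T: "computes tr (?T i) (?P i) (if ?P i then 2 * (1/2) ^ b else 2 * (1/2) ^ (b + d))
      (if ?P i then 3 * (real b + real d) else 3 * real b)" for i
    using computes_boost[OF computes_Ask, where r = "1/2" and c = "\<lambda>x. if x then b + d else b", of tr "Less i s p"]
    by (auto split: if_splits)
  have "computes tr (noisy_find ?T [0..<d]) (List.find ?P [0..<d])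
      (real d * (2 * (1/2) ^ (b + d)) + 2 * (1/2) ^ b) (real d * (3 * real b) + 2 * (3 * (real b + real d)))"
    using computes_noisy_find[where T = ?T and P = ?P and e = "2 * (1/2) ^ b" and f = "2 * (1/2) ^ (b + d)"
        and cT = "3 * (real b + real d)" and cF = "3 * real b" and ?is = "[0..<d]", OF T]
      two_half_power_le_half[OF assms(1)] by simp
  from computes_map[OF this, of "\<lambda>z. z = None"]
  have "computes tr (dom_test d b p s :: (bool \<Rightarrow> 'r ralg) \<Rightarrow> 'r ralg) (List.find ?P [0..<d] = None)
      (real d * (2 * (1/2) ^ (b + d)) + 2 * (1/2) ^ b) (real d * (3 * real b) + 2 * (3 * (real b + real d)))"
    by (simp add: dom_test_def[abs_def])
  moreover have "(List.find ?P [0..<d] = None) = dom_truth tr d p s"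
    by (auto simp: find_None_iff dom_truth_def)
  moreover have "real d * (2 * (1/2) ^ (b + d)) + 2 * (1/2) ^ b \<le> 4 * (1/2::real) ^ b"
    using mult_left_mono[OF real_half_power_le_one[of d], of "2 * (1/2) ^ b"]
    by (simp add: power_add algebra_simps)
  moreover have "real d * (3 * real b) + 2 * (3 * (real b + real d)) \<le> 15 * real b * real d"
  proof -
    have "real b * 1 \<le> real b * real d" "1 * real d \<le> real b * real d"
      using assms by (intro mult_mono; simp)+
    then show ?thesis by (simp add: algebra_simps)
  qed
  ultimately show ?thesis by (auto intro: computes_mono)
qed

definition differs :: "(query \<Rightarrow> bool) \<Rightarrow> nat \<Rightarrow> nat \<Rightarrow> nat \<Rightarrow> bool" where
  "differs tr x y i \<longleftrightarrow> tr (Less i x y) \<or> tr (Less i y x)"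

definition diff_test :: "nat \<Rightarrow> nat \<Rightarrow> nat \<Rightarrow> (bool \<Rightarrow> 'r ralg) \<Rightarrow> 'r ralg" where
  "diff_test x y i K = query_test 4 (Less i x y) (\<lambda>a. query_test 4 (Less i y x) (\<lambda>b. K (a \<or> b)))"

text \<open>Level 4 brings the error to 1/4, within the 1/3 that \<open>boost (1/2)\<close>
  tolerates.\<close>

lemma computes_diff_test: "computes tr (diff_test x y i) (differs tr x y i) (1/4) 24"
proof -
  have "computes tr (\<lambda>K. query_test 4 (Less i x y) (\<lambda>a. query_test 4 (Less i y x) (\<lambda>b. K (a \<or> b))))
     (tr (Less i x y) \<or> tr (Less i y x)) (2 * (1/2) ^ 4 + 2 * (1/2) ^ 4) (3 * real 4 + 3 * real 4)"
    by (rule computes_bind[OF computes_query_test, where Q = "\<lambda>a K. query_test 4 (Less i y x) (\<lambda>b. K (a \<or> b))" and f = "\<lambda>a. a \<or> tr (Less i y x)"])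
      (rule computes_map[OF computes_query_test], simp)
  then show ?thesis
    by (auto simp: diff_test_def[abs_def] differs_def power4_eq_xxxx intro: computes_mono)
qed

text \<open>As in \<open>dom_test\<close>, the distance \<open>5 + d\<close> lets the first
  differing coordinate be found with constant error and \<open>O(d)\<close> queries; the direction
  is asked only there.\<close>

definition lex_test :: "nat \<Rightarrow> nat \<Rightarrow> nat \<Rightarrow> (bool \<Rightarrow> 'r ralg) \<Rightarrow> 'r ralg" where
  "lex_test d x y K =
     noisy_find (\<lambda>i. boost (1/2) (\<lambda>b. if b then 5 + d else 5) (diff_test x y i)) [0..<d]
       (\<lambda>z. case z of None \<Rightarrow> K False | Some i \<Rightarrow> query_test 5 (Less i x y) K)"

definition lex_truth :: "(query \<Rightarrow> bool) \<Rightarrow> nat \<Rightarrow> nat \<Rightarrow> nat \<Rightarrow> bool" where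
  "lex_truth tr d x y \<longleftrightarrow>
     (case List.find (differs tr x y) [0..<d] of None \<Rightarrow> False | Some i \<Rightarrow> tr (Less i x y))"

lemma computes_lex_test:
  assumes "1 \<le> d"
  shows "computes tr (lex_test d x y :: (bool \<Rightarrow> 'r ralg) \<Rightarrow> 'r ralg) (lex_truth tr d x y) (3/16) (1239 * real d)"
proof -
  let ?P = "differs tr x y"
  let ?T = "\<lambda>i. boost (1/2) (\<lambda>b. if b then 5 + d else 5) (diff_test x y i) :: (bool \<Rightarrow> 'r ralg) \<Rightarrow> 'r ralg"
  have T: "computes tr (?T i) (?P i) (if ?P i then 2 * (1/2) ^ 5 else 2 * (1/2) ^ (5 + d))
      (if ?P i then 72 * (5 + real d) else 72 * 5)" for i
    using computes_boost[OF computes_diff_test, where r = "1/2" and c = "\<lambda>b. if b then 5 + d else 5", of tr x y i]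
    by (auto split: if_splits)
  have F: "computes tr (noisy_find ?T [0..<d]) (List.find ?P [0..<d])
      (real d * (2 * (1/2) ^ (5 + d)) + 2 * (1/2) ^ 5) (real d * (72 * 5) + 2 * (72 * (5 + real d)))"
    using computes_noisy_find[where T = ?T and P = ?P and e = "2 * (1/2) ^ 5" and f = "2 * (1/2) ^ (5 + d)"
        and cT = "72 * (5 + real d)" and cF = "72 * 5" and ?is = "[0..<d]", OF T]
      two_half_power_le_half[of 5] by simp
  let ?Q = "\<lambda>z (K :: bool \<Rightarrow> 'r ralg). case z of None \<Rightarrow> K False | Some i \<Rightarrow> query_test 5 (Less i x y) K"
  let ?f = "\<lambda>z. case z of None \<Rightarrow> False | Some i \<Rightarrow> tr (Less i x y)"
  have Q: "computes tr (?Q o') (?f o') (1/16) 15" for o'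
  proof (cases o')
    case None
    then show ?thesis by (auto intro: computes_mono[OF computes_return])
  next
    case (Some i)
    then show ?thesis by (auto intro!: computes_mono[OF computes_query_test] simp: power_divide)
  qed
  have "computes tr (lex_test d x y :: (bool \<Rightarrow> 'r ralg) \<Rightarrow> 'r ralg) (lex_truth tr d x y)
     ((real d * (2 * (1/2) ^ (5 + d)) + 2 * (1/2) ^ 5) + 1/16)
     ((real d * (72 * 5) + 2 * (72 * (5 + real d))) + 15)"
    unfolding lex_test_def[abs_def] lex_truth_def
    by (rule computes_bind[OF F, where Q = ?Q and f = ?f]) (rule Q, simp)
  then show ?thesis
  proof (rule computes_mono)
    show "real d * (2 * (1/2) ^ (5 + d)) + 2 * (1/2) ^ 5 + 1/16 \<le> (3/16::real)"
      using real_half_power_le_one[of d] by (simp add: power_add power_divide)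
    show "real d * (72 * 5) + 2 * (72 * (5 + real d)) + 15 \<le> 1239 * real d"
      using assms by simp
  qed
qed

text \<open>Points dominating \<open>p\<close> are ranked above all others, so that accepting a point that does not
  dominate \<open>p\<close> is corrected later on.\<close>

definition beats_test :: "nat \<Rightarrow> nat \<Rightarrow> nat \<Rightarrow> nat \<Rightarrow> (bool \<Rightarrow> 'r ralg) \<Rightarrow> 'r ralg" where
  "beats_test d p q x K =
     dom_test d 6 p q (\<lambda>a. dom_test d 6 p x (\<lambda>b. lex_test d x q (\<lambda>c. K (a \<and> (\<not> b \<or> c)))))"

definition beats_truth :: "(query \<Rightarrow> bool) \<Rightarrow> nat \<Rightarrow> nat \<Rightarrow> nat \<Rightarrow> nat \<Rightarrow> bool" where
  "beats_truth tr d p q x \<longleftrightarrow> dom_truth tr d p q \<and> (\<not> dom_truth tr d p x \<or> lex_truth tr d x q)"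

text \<open>The levels inside the components give errors 1/16, 1/16 and 3/16, together just under
  the 1/3 that lets \<open>climb\<close> boost this test with base 1/2.\<close>

lemma computes_beats_test:
  assumes "1 \<le> d"
  shows "computes tr (beats_test d p q x :: (bool \<Rightarrow> 'r ralg) \<Rightarrow> 'r ralg) (beats_truth tr d p q x) (1/3) (1500 * real d)"
proof -
  have D: "computes tr (dom_test d 6 p q :: (bool \<Rightarrow> 'r ralg) \<Rightarrow> 'r ralg) (dom_truth tr d p q) (1/16) (90 * real d)" for q
    using assms by (intro computes_mono[OF computes_dom_test]) (auto simp: power_divide)
  note L = computes_lex_test[OF assms, of tr x q, where 'r = 'r]
  have 1: "computes tr (\<lambda>K :: bool \<Rightarrow> 'r ralg. dom_test d 6 p x (\<lambda>b. lex_test d x q (\<lambda>c. K (a \<and> (\<not> b \<or> c)))))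
     (a \<and> (\<not> dom_truth tr d p x \<or> lex_truth tr d x q)) (1/16 + 3/16) (90 * real d + 1239 * real d)" for a
    by (rule computes_bind[OF D, where Q = "\<lambda>b K. lex_test d x q (\<lambda>c. K (a \<and> (\<not> b \<or> c)))"
        and f = "\<lambda>b. a \<and> (\<not> b \<or> lex_truth tr d x q)"]) (rule computes_map[OF L], simp)
  have "computes tr (beats_test d p q x :: (bool \<Rightarrow> 'r ralg) \<Rightarrow> 'r ralg) (beats_truth tr d p q x) (1/16 + (1/16 + 3/16)) (90 * real d + (90 * real d + 1239 * real d))"
    unfolding beats_test_def[abs_def] beats_truth_def
    by (rule computes_bind[OF D, where f = "\<lambda>a. a \<and> (\<not> dom_truth tr d p x \<or> lex_truth tr d x q)"
       and Q = "\<lambda>a K. dom_test d 6 p x (\<lambda>b. lex_test d x q (\<lambda>c. K (a \<and> (\<not> b \<or> c))))"]) (rule 1, simp)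
  then show ?thesis by (rule computes_mono) auto
qed

definition climb :: "nat \<Rightarrow> nat \<Rightarrow> nat \<Rightarrow> nat \<Rightarrow> (nat \<Rightarrow> 'r ralg) \<Rightarrow> 'r ralg" where
  "climb d n L p =
     scan (\<lambda>g q x. boost (1/2) (\<lambda>b. if b then L + g else L) (beats_test d p q x)) [0..<n] 1 p"

lemma computes_climb:
  assumes "1 \<le> d" "2 \<le> L" "p < n" "m < n"
    and m: "\<And>x. x < n \<Longrightarrow> x \<noteq> m \<Longrightarrow> beats_truth tr d p m x" "\<And>x. x < n \<Longrightarrow> \<not> beats_truth tr d p x m"
  shows "computes tr (climb d n L p :: (nat \<Rightarrow> 'r ralg) \<Rightarrow> 'r ralg) m (4 * (1/2) ^ L) (22500 * real d * real n * real L)"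
proof -
  let ?T = "\<lambda>g q x. boost (1/2) (\<lambda>b. if b then L + g else L) (beats_test d p q x :: (bool \<Rightarrow> 'r ralg) \<Rightarrow> 'r ralg)"
  let ?b = "beats_truth tr d p"
  have T: "computes tr (?T g q x) (?b q x) (if ?b q x then 2 * (1/2) ^ L else 2 * (1/2) ^ L * (1/2) ^ g)
      (if ?b q x then (4500 * real d) * (real L + real g) else (4500 * real d) * real L)" for g q x
    using computes_boost[OF computes_beats_test[OF assms(1)], where r = "1/2" and c = "\<lambda>b. if b then L + g else L", of tr p q x]
    by (auto split: if_splits simp: power_add algebra_simps)
  have "computes tr (climb d n L p :: (nat \<Rightarrow> 'r ralg) \<Rightarrow> 'r ralg) m (2 * (2 * (1/2) ^ L)) 
      (real n * (4500 * real d * real L + 2 * (4500 * real d)) + 2 * (4500 * real d))"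
    unfolding climb_def
    using computes_scan[where T = ?T and beats = ?b and e = "2 * (1/2) ^ L" and C = "4500 * real d" and \<beta> = "real L"
        and I = "{..<n}" and m = m and qs = "[0..<n]" and x = p, OF T]
      assms two_half_power_le_half[OF assms(2)] by (simp add: lessThan_atLeast0)
  then show ?thesis
  proof (rule computes_mono)
    have "real n * 1 \<le> real n * real L" using assms by (intro mult_left_mono) auto
    moreover have "1 * 1 \<le> real n * real L" using assms by (intro mult_mono) auto
    ultimately have "real n * real L + 2 * real n + 2 \<le> 5 * (real n * real L)" by linarith
    then have "4500 * real d * (real n * real L + 2 * real n + 2) \<le> 4500 * real d * (5 * (real n * real L))"
      by (rule mult_left_mono) simp
    then show "real n * (4500 * real d * real L + 2 * (4500 * real d)) + 2 * (4500 * real d) \<le> 22500 * real d * real n * real L"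
      by (simp add: algebra_simps)
  qed simp
qed

primrec any_dom_test :: "nat \<Rightarrow> nat \<Rightarrow> nat \<Rightarrow> nat list \<Rightarrow> (bool \<Rightarrow> 'r ralg) \<Rightarrow> 'r ralg" where
  "any_dom_test d b p [] K = K False"
| "any_dom_test d b p (s # S) K = dom_test d b p s (\<lambda>x. any_dom_test d b p S (\<lambda>y. K (x \<or> y)))"

definition covered :: "(query \<Rightarrow> bool) \<Rightarrow> nat \<Rightarrow> nat \<Rightarrow> nat list \<Rightarrow> bool" where
  "covered tr d p S \<longleftrightarrow> (\<exists>s\<in>set S. dom_truth tr d p s)"

lemma computes_any_dom_test:
  assumes "2 \<le> b" "1 \<le> d"
  shows "computes tr (any_dom_test d b p S :: (bool \<Rightarrow> 'r ralg) \<Rightarrow> 'r ralg) (covered tr d p S)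
     (real (length S) * (4 * (1/2) ^ b)) (real (length S) * (15 * real b * real d))"
proof (induction S)
  case Nil
  then show ?case by (simp add: covered_def any_dom_test.simps(1)[abs_def] computes_return)
next
  case (Cons s S)
  have "computes tr (\<lambda>K :: bool \<Rightarrow> 'r ralg. dom_test d b p s (\<lambda>x. any_dom_test d b p S (\<lambda>y. K (x \<or> y))))
     (dom_truth tr d p s \<or> covered tr d p S) (4 * (1/2) ^ b + length S * (4 * (1/2) ^ b)) (15 * real b * real d + real (length S) * (15 * real b * real d))"
    using computes_bind[OF computes_dom_test[OF assms, of tr p s],
        where Q = "\<lambda>x K. any_dom_test d b p S (\<lambda>y. K (x \<or> y))" and f = "\<lambda>x. x \<or> covered tr d p S", OF computes_map[OF Cons]]
    by simp
  then show ?case by (simp add: covered_def any_dom_test.simps(2)[abs_def] algebra_simps)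
qed

text \<open>A round at level \<open>2 * L\<close> is so reliable that each step of the walk is worth
  a factor \<open>(1/2) ^ L\<close>. Hence "covered" is accepted at distance 1, which keeps covered
  points cheap; the opposite answer is \<open>a\<close> steps away and expensive only for uncovered
  points.\<close>

definition cover_test :: "nat \<Rightarrow> nat \<Rightarrow> nat \<Rightarrow> nat \<Rightarrow> nat list \<Rightarrow> (bool \<Rightarrow> 'r ralg) \<Rightarrow> 'r ralg" where
  "cover_test d L a p S = boost ((1/2) ^ L) (\<lambda>x. if x then 1 else a) (any_dom_test d (2 * L) p S)"

lemma computes_cover_test:
  assumes "1 \<le> d" "1 \<le> L" "32 * real k * (1/2) ^ L \<le> 1" "length S \<le> k"
  shows "computes tr (cover_test d L a p S :: (bool \<Rightarrow> 'r ralg) \<Rightarrow> 'r ralg) (covered tr d p S)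
    (if covered tr d p S then 2 * (1/2) ^ a else 2 * (1/2) ^ L)
    (if covered tr d p S then 90 * real L * d * k else 90 * real L * d * k * a)"
proof -
  let ?r = "(1/2::real) ^ L"
  let ?v = "covered tr d p S"
  have r: "0 < ?r" "?r \<le> 1/2" using power_decreasing[OF assms(2), of "1/2::real"] by auto
  have "length S * (4 * (1/2) ^ (2 * L)) \<le> real k * (4 * (1/2) ^ (2 * L))"
    using assms(4) by (intro mult_right_mono) auto
  also have "\<dots> = 1/8 * (32 * real k * ?r) * ?r" by (simp add: power_mult power2_eq_square power_mult_distrib mult_2 power_add)
  also have "\<dots> \<le> 1/8 * 1 * ?r" using assms(3) r by (intro mult_right_mono mult_left_mono) auto
  also have "\<dots> \<le> ?r / (1 + ?r)" using r by (simp add: field_simps)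
  finally have err: "length S * (4 * (1/2) ^ (2 * L)) \<le> ?r / (1 + ?r)" .
  have U: "computes tr (any_dom_test d (2 * L) p S :: (bool \<Rightarrow> 'r ralg) \<Rightarrow> 'r ralg) ?v (length S * (4 * (1/2) ^ (2 * L))) (30 * real L * d * k)"
  proof (rule computes_mono[OF computes_any_dom_test])
    have "real (length S) * (15 * real (2 * L) * real d) \<le> real k * (15 * real (2 * L) * real d)"
      using assms(4) by (intro mult_right_mono) auto
    then show "real (length S) * (15 * real (2 * L) * real d) \<le> 30 * real L * d * k" by (simp add: mult_ac)
  qed (use assms in auto)
  have B: "computes tr (cover_test d L a p S :: (bool \<Rightarrow> 'r ralg) \<Rightarrow> 'r ralg) ?v (2 * ?r ^ (if \<not> ?v then 1 else a)) (3 * (30 * real L * d * k) * (if ?v then 1 else a))"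
    unfolding cover_test_def using computes_boost[OF U _ r err, where c = "\<lambda>x. if x then 1 else a"] by simp
  have "?r ^ a \<le> (1/2) ^ a" using r by (intro power_mono) auto
  then show ?thesis using B by (intro computes_mono[OF B]) auto
qed

section \<open>Skyline computation\<close>

lemma lex_truth_iff:
  "lex_truth tr d x y \<longleftrightarrow> (\<exists>i<d. tr (Less i x y) \<and> (\<forall>j<i. \<not> differs tr x y j))"
proof
  assume "lex_truth tr d x y"
  then show "\<exists>i<d. tr (Less i x y) \<and> (\<forall>j<i. \<not> differs tr x y j)"
    by (auto simp: lex_truth_def find_Some_iff split: option.splits)
next
  assume "\<exists>i<d. tr (Less i x y) \<and> (\<forall>j<i. \<not> differs tr x y j)"
  then obtain i where i: "i < d" "tr (Less i x y)" "\<forall>j<i. \<not> differs tr x y j" by blast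
  then have "List.find (differs tr x y) [0..<d] = Some i"
    by (auto simp: find_Some_iff differs_def intro!: exI[of _ i])
  then show "lex_truth tr d x y" using i by (simp add: lex_truth_def)
qed

lemma differs_truth:
  "x < length xs \<Longrightarrow> y < length xs \<Longrightarrow>
     differs (truth d xs) x y i \<longleftrightarrow> i < d \<and> xs ! x ! i \<noteq> xs ! y ! i"
  by (auto simp: differs_def)

lemma lex_truth_truth:
  assumes "x < length xs" "y < length xs"
  shows "lex_truth (truth d xs) d x y \<longleftrightarrow>
     (\<exists>i<d. xs ! x ! i < xs ! y ! i \<and> (\<forall>j<i. xs ! x ! j = xs ! y ! j))"
  unfolding lex_truth_iff by (rule ex_cong) (use assms in \<open>auto simp: differs_truth\<close>)

lemma dom_truth_truth:
  "p < length xs \<Longrightarrow> s < length xs \<Longrightarrow>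
     dom_truth (truth d xs) d p s \<longleftrightarrow> dominated d (xs ! p) (xs ! s)"
  by (auto simp: dom_truth_def dominated_def not_less)

lemma lex_truth_total:
  assumes "distinct xs" "set xs \<subseteq> points d" "x < length xs" "y < length xs" "x \<noteq> y"
  shows "lex_truth (truth d xs) d x y \<or> lex_truth (truth d xs) d y x"
proof -
  have "xs ! x \<noteq> xs ! y" using assms by (simp add: nth_eq_iff_index_eq)
  moreover have "length (xs ! x) = d" "length (xs ! y) = d"
    using nth_mem[OF assms(3)] nth_mem[OF assms(4)] assms(2) unfolding points_def by blast+
  ultimately have ex: "\<exists>i. i < d \<and> xs ! x ! i \<noteq> xs ! y ! i" by (metis nth_equalityI)
  define i where "i = (LEAST i. i < d \<and> xs ! x ! i \<noteq> xs ! y ! i)"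
  have i: "i < d" "xs ! x ! i \<noteq> xs ! y ! i" using LeastI_ex[OF ex] by (auto simp: i_def)
  have "xs ! x ! j = xs ! y ! j" if "j < i" for j
    using not_less_Least[OF that[unfolded i_def]] that i by auto
  then show ?thesis using i assms by (auto simp: lex_truth_truth neq_iff)
qed

lemma lex_truth_irrefl: "\<not> lex_truth (truth d xs) d x x"
  by (auto simp: lex_truth_iff)

lemma lex_truth_trans:
  assumes "x < length xs" "y < length xs" "z < length xs"
    and "lex_truth (truth d xs) d x y" "lex_truth (truth d xs) d y z"
  shows "lex_truth (truth d xs) d x z"
proof -
  obtain i where i: "i < d" "xs ! x ! i < xs ! y ! i" "\<forall>j<i. xs ! x ! j = xs ! y ! j"
    using assms by (auto simp: lex_truth_truth)
  obtain i' where i': "i' < d" "xs ! y ! i' < xs ! z ! i'" "\<forall>j<i'. xs ! y ! j = xs ! z ! j"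
    using assms by (auto simp: lex_truth_truth)
  have "xs ! x ! min i i' < xs ! z ! min i i'"
    using i i' by (cases i i' rule: linorder_cases) (auto simp: min_def)
  moreover have "\<forall>j<min i i'. xs ! x ! j = xs ! z ! j" using i i' by auto
  ultimately show ?thesis using i i' assms by (auto simp: lex_truth_truth intro!: exI[of _ "min i i'"])
qed

text \<open>The target is the lexicographic maximum of the points dominating \<open>p\<close>. A
  point strictly dominating it would also dominate \<open>p\<close> and be lexicographically larger.
  By totality of the lexicographic order it beats every other position.\<close>

lemma exists_climb_target:
  assumes "distinct xs" "set xs \<subseteq> points d" "p < length xs"
  shows "\<exists>m<length xs. dom_truth (truth d xs) d p m \<and> xs ! m \<in> skyline d (set xs) \<and>
    (\<forall>x<length xs. x \<noteq> m \<longrightarrow> beats_truth (truth d xs) d p m x) \<and>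
    (\<forall>x<length xs. \<not> beats_truth (truth d xs) d p x m)"
proof -
  define A where "A = {q. q < length xs \<and> dom_truth (truth d xs) d p q}"
  let ?l = "lex_truth (truth d xs) d"
  have "p \<in> A" using assms by (simp add: A_def dom_truth_truth dominated_def)
  moreover have "transp_on A ?l"
    by (rule transp_onI) (auto simp: A_def intro: lex_truth_trans)
  moreover have "asymp_on A ?l"
  proof (rule asymp_onI)
    fix x y assume "x \<in> A" "y \<in> A" "?l x y"
    then show "\<not> ?l y x"
      using lex_truth_trans[of x xs y x d] lex_truth_irrefl[of d xs x] by (auto simp: A_def)
  qed
  moreover have "finite A" by (simp add: A_def)
  ultimately obtain m where m: "m \<in> A" "\<forall>x\<in>A. x \<noteq> m \<longrightarrow> \<not> ?l m x"
    using Finite_Set.bex_max_element[of A ?l] by blast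
  have mn: "m < length xs" "dom_truth (truth d xs) d p m" using m by (auto simp: A_def)
  have "xs ! m \<in> skyline d (set xs)"
  proof (rule ccontr)
    assume "xs ! m \<notin> skyline d (set xs)"
    then obtain z where z: "z < length xs" "strictly_dominated d (xs ! m) (xs ! z)" "xs ! z \<noteq> xs ! m"
      using mn by (auto simp: skyline_def in_set_conv_nth)
    have "z \<in> A"
      using z mn assms(3) by (fastforce simp: A_def dom_truth_truth strictly_dominated_def dominated_def)
    moreover have zm: "z \<noteq> m" using z by auto
    ultimately have "\<not> ?l m z" using m by blast
    then have "?l z m" using lex_truth_total[OF assms(1,2) z(1) mn(1)] zm by blast
    then show False
      using z mn by (fastforce simp: lex_truth_truth strictly_dominated_def dominated_def)
  qed
  moreover have "beats_truth (truth d xs) d p m x" if "x < length xs" "x \<noteq> m" for x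
    using m that mn lex_truth_total[OF assms(1,2) that(1) mn(1)] by (auto simp: beats_truth_def A_def)
  moreover have "\<not> beats_truth (truth d xs) d p x m" if "x < length xs" for x
    using m that mn lex_truth_irrefl[of d xs m] by (cases "x = m") (auto simp: beats_truth_def A_def)
  ultimately show ?thesis using mn by blast
qed

text \<open>Distinct points are lexicographically comparable, so domination between them is strict
  in some coordinate. Thus a skyline point is covered only by itself, and a correct pass started
  from it returns it.\<close>

lemma skyline_dominated_eq:
  assumes "distinct xs" "set xs \<subseteq> points d" "p < length xs" "s < length xs"
    and "xs ! p \<in> skyline d (set xs)" "dom_truth (truth d xs) d p s"
  shows "p = s"
proof (rule ccontr)
  assume ps: "p \<noteq> s"
  have "\<not> lex_truth (truth d xs) d s p"
    using assms(6) by (auto simp: lex_truth_iff dom_truth_def)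
  then have "lex_truth (truth d xs) d p s" using lex_truth_total[OF assms(1-4) ps] by blast
  then obtain i where "i < d" "xs ! p ! i < xs ! s ! i" using assms by (auto simp: lex_truth_truth)
  moreover have "dominated d (xs ! p) (xs ! s)" using assms dom_truth_truth by blast
  ultimately have "strictly_dominated d (xs ! p) (xs ! s)" by (auto simp: strictly_dominated_def)
  moreover have "xs ! s \<noteq> xs ! p" using assms ps by (simp add: nth_eq_iff_index_eq)
  ultimately show False using assms by (auto simp: skyline_def)
qed

definition greedy_skyline :: "nat \<Rightarrow> nat \<Rightarrow> nat \<Rightarrow> nat \<Rightarrow> nat set ralg" where
  "greedy_skyline k n d L = greedy (cover_test d L (n div k + 1)) (climb d n L) k [0..<n] []"

lemma greedy_skyline_bounds:
  assumes xs: "distinct xs" "set xs \<subseteq> points d" "length xs = n"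
    and k: "card {j. j < n \<and> xs ! j \<in> skyline d (set xs)} \<le> k" "1 \<le> k" "k \<le> n"
    and d: "1 \<le> d" and L: "32 * real k * (1/2) ^ L \<le> \<delta>" "\<delta> < 1"
  shows "bnd (truth d xs) 1 (\<lambda>_. 0) (greedy_skyline k n d L) (300000 * real d * real k * real n * real L)"
    and "bnd (truth d xs) 0 (\<lambda>x. if x = {j. j < n \<and> xs ! j \<in> skyline d (set xs)} then 0 else 1) (greedy_skyline k n d L) \<delta>"
proof -
  let ?tr = "truth d xs"
  define Y where "Y = {j. j < n \<and> xs ! j \<in> skyline d (set xs)}"
  define a where "a = n div k + 1"
  define h where "h = (1/2::real) ^ L"
  have h0: "0 < h" by (simp add: h_def)
  have kh: "32 * (real k * h) \<le> \<delta>" using L by (simp add: h_def)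
  have hk: "h \<le> real k * h" using k h0 by simp
  have h32: "h \<le> 1/32" using kh hk L(2) by linarith
  have L5: "5 \<le> L"
  proof (rule ccontr)
    assume "\<not> 5 \<le> L"
    then have "(1/2::real) ^ 4 \<le> h" unfolding h_def by (intro power_decreasing) auto
    then show False using h32 by (simp add: power4_eq_xxxx)
  qed
  obtain m where m: "\<And>p. p < n \<Longrightarrow> m p < n" "\<And>p. p < n \<Longrightarrow> dom_truth ?tr d p (m p)"
    "\<And>p. p < n \<Longrightarrow> xs ! m p \<in> skyline d (set xs)"
    "\<And>p x. p < n \<Longrightarrow> x < n \<Longrightarrow> x \<noteq> m p \<Longrightarrow> beats_truth ?tr d p (m p) x"
    "\<And>p x. p < n \<Longrightarrow> x < n \<Longrightarrow> \<not> beats_truth ?tr d p x (m p)"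
  proof -
    have "\<forall>p. \<exists>m. p < n \<longrightarrow> m < n \<and> dom_truth ?tr d p m \<and> xs ! m \<in> skyline d (set xs) \<and>
      (\<forall>x<n. x \<noteq> m \<longrightarrow> beats_truth ?tr d p m x) \<and> (\<forall>x<n. \<not> beats_truth ?tr d p x m)"
      using exists_climb_target[OF xs(1,2)] xs(3) by blast
    from choice[OF this] show ?thesis using that by blast
  qed
  define P where "P = 22500 * real d * real n * real L"
  define cT where "cT = 90 * real L * d * k"
  define cF where "cF = 90 * real L * d * k * a"
  have P: "computes ?tr (climb d n L p) (m p) (4 * h) P" if "p \<in> set [0..<n]" for p
    unfolding P_def h_def using that m d L5 by (intro computes_climb) auto
  have T: "computes ?tr (cover_test d L a p S) (covered ?tr d p S)
     (if covered ?tr d p S then 2 * (1/2) ^ a else 2 * h) (if covered ?tr d p S then cT else cF)"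
    if "length S \<le> k" for p S
    unfolding cT_def cF_def h_def using that d L L5 by (intro computes_cover_test) auto
  have mS: "m p \<notin> set S" if "p \<in> set [0..<n]" "\<not> covered ?tr d p S" for p S
    using that m(2) by (auto simp: covered_def)
  have eT: "real n * (2 * (1/2) ^ a) \<le> 2 * real k"
  proof -
    have "n \<le> k * a" unfolding a_def using k(2) by (simp add: dividend_less_times_div less_imp_le)
    then have "real n \<le> real k * real a" by (metis of_nat_le_iff of_nat_mult)
    then have "real n * (1/2) ^ a \<le> real k * real a * (1/2) ^ a" by (rule mult_right_mono) simp
    also have "\<dots> = real k * (real a * (1/2) ^ a)" by simp
    also have "\<dots> \<le> real k * 1" by (intro mult_left_mono real_half_power_le_one) auto
    finally show ?thesis by simp
  qed
  show "bnd ?tr 1 (\<lambda>_. 0) (greedy_skyline k n d L) (300000 * real d * real k * real n * real L)"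
  proof -
    have B: "bnd ?tr 1 (\<lambda>_. 0) (greedy_skyline k n d L)
        (length [0..<n] * (cT + 2 * (1/2) ^ a * P) + 3 * (real k + 1 - length ([] :: nat list)) * (cF + P))"
      unfolding greedy_skyline_def a_def[symmetric]
      by (rule greedy_cost[OF T P mS]) (use h0 h32 in \<open>auto simp: cT_def cF_def P_def\<close>)
    define U where "U = real d * real k * real n * real L"
    have ka: "k * a \<le> 2 * n" using k times_div_less_eq_dividend[of k n] unfolding a_def distrib_left by linarith
    then have ka: "real k * real a \<le> 2 * real n" by (metis of_nat_le_iff of_nat_mult of_nat_numeral)
    have "real n * (cT + 2 * (1/2) ^ a * P) = 90 * U + real n * (2 * (1/2) ^ a) * P"
      by (simp add: cT_def U_def algebra_simps)
    also have "\<dots> \<le> 90 * U + 2 * real k * P"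
      using eT by (intro add_left_mono mult_right_mono) (auto simp: P_def)
    also have "\<dots> = 45090 * U" by (simp add: U_def P_def)
    finally have 1: "real n * (cT + 2 * (1/2) ^ a * P) \<le> 45090 * U" .
    have "3 * (real k + 1) * (cF + P) \<le> 6 * real k * (cF + P)"
      using k by (intro mult_right_mono) (auto simp: cF_def P_def)
    also have "\<dots> = 540 * real L * real d * real k * (real k * real a) + 135000 * U"
      by (simp add: cF_def P_def U_def algebra_simps)
    also have "\<dots> \<le> 540 * real L * real d * real k * (2 * real n) + 135000 * U"
      using ka by (intro add_right_mono mult_left_mono) auto
    also have "\<dots> = 136080 * U" by (simp add: U_def)
    finally have 2: "3 * (real k + 1) * (cF + P) \<le> 136080 * U" .
    have 3: "300000 * real d * real k * real n * real L = 300000 * U" by (simp add: U_def)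
    have "0 \<le> U" by (simp add: U_def)
    then show ?thesis
      unfolding 3 using 1 2 by (intro bnd_mono[OF B]) simp
  qed
  show "bnd ?tr 0 (\<lambda>x. if x = {j. j < n \<and> xs ! j \<in> skyline d (set xs)} then 0 else 1) (greedy_skyline k n d L) \<delta>"
  proof -
    have cov: "p \<in> set S" if "p \<in> Y" "set S \<subseteq> Y" "covered ?tr d p S" for p S
      using that skyline_dominated_eq[OF xs(1,2), of p] xs(3) by (fastforce simp: covered_def Y_def)
    have mY: "m p = p" if "p \<in> Y" for p
      using that m skyline_dominated_eq[OF xs(1,2), of p "m p"] xs(3) by (auto simp: Y_def)
    have B: "bnd ?tr 0 (\<lambda>x. if x = Y then 0 else 1) (greedy_skyline k n d L)
       ((real k - length ([] :: nat list)) * (4 * h) + length (filter (\<lambda>p. p \<in> Y) [0..<n]) * (2 * h)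
          + length [0..<n] * (2 * (1/2) ^ a * (4 * h)))"
      unfolding greedy_skyline_def a_def[symmetric]
      by (rule greedy_error[OF T P mS]) (use mY cov m h0 k(1) in \<open>auto simp: Y_def\<close>)
    have "length (filter (\<lambda>p. p \<in> Y) [0..<n]) = card Y"
    proof -
      have "Y = set (filter (\<lambda>p. p \<in> Y) [0..<n])" by (auto simp: Y_def)
      then show ?thesis by (metis distinct_card distinct_filter distinct_upt)
    qed
    then have "real (length (filter (\<lambda>p. p \<in> Y) [0..<n])) * (2 * h) \<le> real k * (2 * h)"
      using k(1) h0 by (intro mult_right_mono) (auto simp: Y_def)
    moreover have "real n * (2 * (1/2) ^ a * (4 * h)) \<le> 2 * real k * (4 * h)"
      using mult_right_mono[OF eT, of "4 * h"] h0 by (simp add: mult_ac)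
    moreover have "real k * (4 * h) + real k * (2 * h) + 2 * real k * (4 * h) \<le> 32 * (real k * h)"
      using h0 by (simp add: algebra_simps)
    ultimately show ?thesis
      using kh unfolding Y_def[symmetric] 
      by (intro bnd_mono[OF B]) (unfold length_upt list.size minus_nat.diff_0 of_nat_0 diff_zero, linarith)
  qed
qed

section \<open>Output probability and expected number of queries\<close>

lemma output_prob_geI:
  assumes "c \<le> measure_pmf.prob (run orc m 0 a) {z. fst z = Some r}"
  shows "c \<le> output_prob orc a r"
  unfolding output_prob_def
  using assms by (intro cSUP_upper2[where x = m]) (auto intro!: bdd_aboveI[of _ 1] measure_pmf.prob_le_1)

lemma output_prob_ge:
  assumes "bnd (truth d xs) 0 (\<lambda>x. if x = r then 0 else 1) a B" "admissible_accuracy acc"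
  shows "1 - B \<le> output_prob (noisy_oracle acc d xs) a r"
  using run_prob_ge[OF assms] by (blast intro: output_prob_geI)

lemma expected_queries_le:
  assumes "bnd (truth d xs) 1 (\<lambda>_. 0) a B" "admissible_accuracy acc"
  shows "expected_queries (noisy_oracle acc d xs) a \<le> ennreal B"
  unfolding expected_queries_def
  using expected_queries_run_le[OF assms, of _ 0] by (auto intro!: SUP_least)

definition with_prob :: "real \<Rightarrow> 'r ralg \<Rightarrow> 'r \<Rightarrow> 'r ralg" where
  "with_prob p a r = Sample (map_pmf (\<lambda>b. if b then 1 else 0) (bernoulli_pmf p)) (\<lambda>x. if x = 1 then a else Return r)"

lemma run_with_prob:
  "run orc (Suc m) t (with_prob p a r) = bind_pmf (bernoulli_pmf p) (\<lambda>b. run orc m t (if b then a else Return r))"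
  by (simp add: with_prob_def bind_map_pmf if_distrib cong: if_cong)

text \<open>\<open>bnd\<close> has no rule for \<open>Sample\<close>, so the coin at the root is
  treated directly in \<open>run\<close>, where it takes up one node.\<close>

lemma output_prob_with_prob:
  assumes "bnd (truth d xs) 0 (\<lambda>x. if x = r then 0 else 1) a B" "admissible_accuracy acc" "0 \<le> p" "p \<le> 1"
  shows "p * (1 - B) \<le> output_prob (noisy_oracle acc d xs) (with_prob p a r') r"
proof -
  obtain m where "1 - B \<le> measure_pmf.prob (run (noisy_oracle acc d xs) m 0 a) {z. fst z = Some r}"
    using run_prob_ge[OF assms(1,2)] by blast
  then have "p * (1 - B) \<le> p * measure_pmf.prob (run (noisy_oracle acc d xs) m 0 a) {z. fst z = Some r}"
    using assms by (intro mult_left_mono)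
  also have "\<dots> \<le> measure_pmf.prob (run (noisy_oracle acc d xs) (Suc m) 0 (with_prob p a r')) {z. fst z = Some r}"
    unfolding run_with_prob using assms by (simp add: prob_bind_bernoulli)
  finally show ?thesis by (rule output_prob_geI)
qed

lemma expected_queries_with_prob:
  assumes "bnd (truth d xs) 1 (\<lambda>_. 0) a B" "admissible_accuracy acc" "0 \<le> p" "p \<le> 1"
  shows "expected_queries (noisy_oracle acc d xs) (with_prob p a r) \<le> ennreal (p * B)"
  unfolding expected_queries_def
proof (rule SUP_least)
  fix m
  have B: "0 \<le> B" using bnd_nonneg[OF assms(1)] by simp
  show "(\<integral>\<^sup>+ z. of_nat (snd z) \<partial>measure_pmf (run (noisy_oracle acc d xs) m 0 (with_prob p a r))) \<le> ennreal (p * B)"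
  proof (cases m)
    case (Suc m')
    let ?I = "\<lambda>a. \<integral>\<^sup>+ z. of_nat (snd z) \<partial>measure_pmf (run (noisy_oracle acc d xs) m' 0 a)"
    have "(\<integral>\<^sup>+ z. of_nat (snd z) \<partial>measure_pmf (run (noisy_oracle acc d xs) m 0 (with_prob p a r)))
      = ?I a * ennreal p + ?I (Return r) * ennreal (1 - p)"
      unfolding Suc run_with_prob using assms by (simp add: nn_integral_bernoulli_pmf)
    also have "?I (Return r) = 0" by (cases m') auto
    also have "?I a * ennreal p + 0 * ennreal (1 - p) \<le> ennreal B * ennreal p"
      using expected_queries_run_le[OF assms(1,2), of m' 0] by (auto intro!: mult_right_mono)
    finally show ?thesis using assms B by (simp add: ennreal_mult'' mult.commute)
  qed simp
qed

section \<open>Choice of the level and the final algorithm\<close>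

definition level :: "nat \<Rightarrow> real \<Rightarrow> nat" where
  "level k \<delta> = nat \<lceil>log 2 (real k / \<delta>)\<rceil> + 5"

text \<open>The summand 5 in \<open>level\<close> supplies the factor 32.\<close>

lemma level_error:
  assumes "1 \<le> k" "0 < \<delta>"
  shows "32 * real k * (1/2) ^ level k \<delta> \<le> \<delta>"
proof -
  have pos: "0 < real k / \<delta>" using assms by simp
  have "real k / \<delta> = 2 powr log 2 (real k / \<delta>)" using pos by simp
  also have "\<dots> \<le> 2 powr real (nat \<lceil>log 2 (real k / \<delta>)\<rceil>)"
    by (intro powr_mono real_nat_ceiling_ge) auto
  also have "\<dots> = 2 ^ nat \<lceil>log 2 (real k / \<delta>)\<rceil>" by (simp add: powr_realpow)
  finally show ?thesis
    using assms by (simp add: level_def power_add power_one_over field_simps)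
qed

text \<open>Rounding up and the summand 5 add at most 6, hence at most 6 times the binary logarithm,
  which is at least 1 here. Passing to \<open>ln\<close> costs a factor 2, because
  \<open>ln 2\<close> is at least 1/2.\<close>

lemma level_le:
  assumes "2 \<le> real k / \<delta>"
  shows "real (level k \<delta>) \<le> 14 * ln (real k / \<delta>)"
proof -
  have l1: "1 \<le> log 2 (real k / \<delta>)" using assms by (subst le_log_iff) auto
  have "real (nat \<lceil>log 2 (real k / \<delta>)\<rceil>) \<le> log 2 (real k / \<delta>) + 1"
    using l1 of_int_ceiling_le_add_one[of "log 2 (real k / \<delta>)"] by simp
  then have "real (level k \<delta>) \<le> 7 * log 2 (real k / \<delta>)" using l1 unfolding level_def of_nat_add by linarith
  moreover have "log 2 (real k / \<delta>) \<le> 2 * ln (real k / \<delta>)"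
  proof -
    have "1 / 2 \<le> ln (2::real)" using ln_le_minus_one[of "1/2 :: real"] by (simp add: ln_div)
    moreover have "0 \<le> ln (real k / \<delta>)" using assms by (intro ln_ge_zero) simp
    ultimately have "ln (real k / \<delta>) * 1 \<le> ln (real k / \<delta>) * (2 * ln 2)" by (intro mult_left_mono) auto
    then show ?thesis by (simp add: log_def field_simps)
  qed
  ultimately show ?thesis by simp
qed

text \<open>If \<open>k = 1\<close> and \<open>\<delta>\<close> tends to 1 then \<open>ln (k / \<delta>)\<close> tends to 0, which leaves less than one query.
  In this case the algorithm for error \<open>1/2\<close> (for which level 6 suffices) is run with probability
  \<open>2 * (1 - \<delta>)\<close> only.\<close>

definition skyline_alg :: "nat \<Rightarrow> nat \<Rightarrow> nat \<Rightarrow> real \<Rightarrow> nat set ralg" where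
  "skyline_alg k n d \<delta> =
     (if n = 0 \<or> d = 0 then Return {..<n}
      else if 2 \<le> real k / \<delta> then greedy_skyline (min k n) n d (level k \<delta>)
      else with_prob (2 * (1 - \<delta>)) (greedy_skyline 1 n d 6) {})"

lemma skyline_dim_zero: "X \<subseteq> points 0 \<Longrightarrow> skyline 0 X = X"
  by (auto simp: skyline_def strictly_dominated_def)

lemma skyline_alg_correct:
  assumes xs: "distinct xs" "set xs \<subseteq> points d" "length xs = n"
    and \<delta>: "0 < \<delta>" "\<delta> < 1" and k: "card (skyline d (set xs)) \<le> k" and acc: "admissible_accuracy acc"
  shows "output_prob (noisy_oracle acc d xs) (skyline_alg k n d \<delta>) {j. j < n \<and> xs ! j \<in> skyline d (set xs)} \<ge> 1 - \<delta> \<and>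
     expected_queries (noisy_oracle acc d xs) (skyline_alg k n d \<delta>)
       \<le> ennreal (4200000 * (real d * real k * real n * ln (real k / \<delta>)))"
proof -
  let ?Y = "{j. j < n \<and> xs ! j \<in> skyline d (set xs)}"
  show ?thesis
  proof (cases "n = 0 \<or> d = 0")
    case True
    \<comment> \<open>The required bound on queries is 0 in this case, so the answer is given
      without asking; in dimension 0 no point strictly dominates another.\<close>
    then have "?Y = {..<n}" using skyline_dim_zero[of "set xs"] xs by (auto simp: in_set_conv_nth)
    moreover have "bnd (truth d xs) 0 (\<lambda>x. if x = ?Y then 0 else 1) (Return ?Y) 0" by (rule bnd_Return) simp
    moreover have "bnd (truth d xs) 1 (\<lambda>_. 0) (Return ?Y) 0" by (rule bnd_Return) simp
    ultimately show ?thesis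
      using True output_prob_ge[OF _ acc, of d xs ?Y "Return ?Y" 0] expected_queries_le[OF _ acc, of d xs "Return ?Y" 0] \<delta>
      by (auto simp: skyline_alg_def)
  next
    case False
    then have n: "1 \<le> n" and d: "1 \<le> d" by auto
    have inj: "inj_on (\<lambda>j. xs ! j) ?Y" using xs by (auto simp: inj_on_def nth_eq_iff_index_eq)
    have "card ?Y = card ((\<lambda>j. xs ! j) ` ?Y)" using inj by (simp add: card_image)
    also have "\<dots> \<le> card (skyline d (set xs))"
      by (rule card_mono) (auto simp: skyline_def)
    finally have Yk: "card ?Y \<le> k" using k by simp
    have Yn: "card ?Y \<le> n" using card_mono[of "{..<n}" ?Y] by auto
    \<comment> \<open>A nonempty set has a nonempty skyline, which forces \<open>k\<close> to be
      positive.\<close>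
    obtain j where "j \<in> ?Y" using exists_climb_target[OF xs(1,2), of 0] n xs(3) by auto
    then have "card ?Y \<noteq> 0" by (auto simp: card_eq_0_iff)
    then have k1: "1 \<le> k" using Yk by linarith
    show ?thesis
    proof (cases "2 \<le> real k / \<delta>")
      case True
      define L where "L = level k \<delta>"
      \<comment> \<open>Capping at \<open>n\<close> provides the condition \<open>k \<le> n\<close>
        of \<open>greedy_skyline_bounds\<close>; the level chosen for the original \<open>k\<close>
        is still sufficient.\<close>
      have "32 * real (min k n) * (1/2) ^ L \<le> 32 * real k * (1/2) ^ L" by (intro mult_right_mono) auto
      also have "\<dots> \<le> \<delta>" unfolding L_def using k1 \<delta> by (intro level_error)
      finally have L: "32 * real (min k n) * (1/2) ^ L \<le> \<delta>" .
      note B = greedy_skyline_bounds[OF xs _ _ _ d L \<delta>(2)]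
      have "300000 * real d * real (min k n) * real n * real L \<le> 300000 * real d * real k * real n * (14 * ln (real k / \<delta>))"
        unfolding L_def by (intro mult_mono level_le[OF True]) auto
      also have "\<dots> = 4200000 * (real d * real k * real n * ln (real k / \<delta>))" by simp
      finally have "bnd (truth d xs) 1 (\<lambda>_. 0) (greedy_skyline (min k n) n d L) (4200000 * (real d * real k * real n * ln (real k / \<delta>)))"
        using Yk Yn k1 n by (intro bnd_mono[OF B(1)]) auto
      moreover have "bnd (truth d xs) 0 (\<lambda>x. if x = ?Y then 0 else 1) (greedy_skyline (min k n) n d L) \<delta>"
        using Yk Yn k1 n by (intro B(2)) auto
      ultimately show ?thesis
        using False True
        by (auto simp: skyline_alg_def L_def intro: output_prob_ge[OF _ acc] expected_queries_le[OF _ acc])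
    next
      case F: False
      then have "real k < 2 * \<delta>" using \<delta> by (simp add: field_simps)
      then have k_eq: "k = 1" and d2: "1/2 < \<delta>" using \<delta> k1 by linarith+
      have B: "bnd (truth d xs) 1 (\<lambda>_. 0) (greedy_skyline 1 n d 6) (300000 * real d * real 1 * real n * real 6)"
         "bnd (truth d xs) 0 (\<lambda>x. if x = ?Y then 0 else 1) (greedy_skyline 1 n d 6) (1/2)"
        using Yk k_eq n by (intro greedy_skyline_bounds[OF xs _ _ _ d, where \<delta> = "1/2"]; simp add: power_divide)+
      have p: "0 \<le> 2 * (1 - \<delta>)" "2 * (1 - \<delta>) \<le> 1" using \<delta> d2 by auto
      \<comment> \<open>The run succeeds with probability at least
        \<open>2 * (1 - \<delta>) * (1/2)\<close>. Its expected cost is also proportional to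
        \<open>1 - \<delta>\<close>, and this inequality compares it with the required
        logarithm.\<close>
      have "1 - \<delta> \<le> ln (1 / \<delta>)" using \<delta> ln_le_minus_one[of \<delta>] by (simp add: ln_div)
      moreover have "0 \<le> 1 - \<delta>" using \<delta> by simp
      ultimately have "real d * real n * (3600000 * (1 - \<delta>)) \<le> real d * real n * (4200000 * ln (1 / \<delta>))"
        by (intro mult_left_mono) auto
      then have "2 * (1 - \<delta>) * (300000 * real d * real 1 * real n * real 6) \<le> 4200000 * (real d * real k * real n * ln (real k / \<delta>))"
        by (simp add: k_eq mult_ac)
      then have "expected_queries (noisy_oracle acc d xs) (with_prob (2 * (1 - \<delta>)) (greedy_skyline 1 n d 6) {})
         \<le> ennreal (4200000 * (real d * real k * real n * ln (real k / \<delta>)))"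
        using expected_queries_with_prob[OF B(1) acc p] by (meson ennreal_leI order_trans)
      then show ?thesis
        using False F output_prob_with_prob[OF B(2) acc p, of "{}"] by (simp add: skyline_alg_def)
    qed
  qed
qed

theorem theorem7:
  "\<exists>(A :: nat \<Rightarrow> nat \<Rightarrow> nat \<Rightarrow> real \<Rightarrow> nat set ralg) (C :: real). C > 0 \<and>
     (\<forall>(k :: nat) (n :: nat) (d :: nat) (\<delta> :: real) (X :: real list set) (xs :: real list list)
        (acc :: nat \<Rightarrow> query \<Rightarrow> real).
        X \<subseteq> points d \<and> finite X \<and> card X = n \<and> distinct xs \<and> set xs = X \<and>
        0 < \<delta> \<and> \<delta> < 1 \<and> card (skyline d X) \<le> k \<and> admissible_accuracy acc \<longrightarrow>
        output_prob (noisy_oracle acc d xs) (A k n d \<delta>) {j. j < n \<and> xs ! j \<in> skyline d X} \<ge> 1 - \<delta> \<and>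
        expected_queries (noisy_oracle acc d xs) (A k n d \<delta>)
          \<le> ennreal (C * (real d * real k * real n * ln (real k / \<delta>))))"
proof (intro exI[of _ skyline_alg] exI[of _ 4200000] conjI allI impI)
  fix k n d :: nat and \<delta> :: real and X :: "real list set" and xs :: "real list list" and acc
  assume *: "X \<subseteq> points d \<and> finite X \<and> card X = n \<and> distinct xs \<and> set xs = X \<and>
    0 < \<delta> \<and> \<delta> < 1 \<and> card (skyline d X) \<le> k \<and> admissible_accuracy acc"
  then have "length xs = n" by (auto simp: distinct_card)
  with * have "output_prob (noisy_oracle acc d xs) (skyline_alg k n d \<delta>) {j. j < n \<and> xs ! j \<in> skyline d X} \<ge> 1 - \<delta> \<and>
     expected_queries (noisy_oracle acc d xs) (skyline_alg k n d \<delta>)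
       \<le> ennreal (4200000 * (real d * real k * real n * ln (real k / \<delta>)))"
    using skyline_alg_correct[of xs d n \<delta> k acc] by blast
  then show "output_prob (noisy_oracle acc d xs) (skyline_alg k n d \<delta>) {j. j < n \<and> xs ! j \<in> skyline d X} \<ge> 1 - \<delta>"
    and "expected_queries (noisy_oracle acc d xs) (skyline_alg k n d \<delta>)
       \<le> ennreal (4200000 * (real d * real k * real n * ln (real k / \<delta>)))" by auto
qed simp

end
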